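(* Let $0<\alpha\le2$, let $\lambda=(\lambda_1,\lambda_2,\dots)\in\ell_1$ with $\lambda_1\ge\lambda_2\ge\dots>0$, and let $\nu$ be the symmetric stable probability measure on $\ell_2$ with characteristic function $$\widehat\nu(y)=\exp\Big\{-\tfrac12\Big(\sum_{i=1}^\infty\lambda_iy_i^2\Big)^{\alpha/2}\Big\},\qquad y\in\ell_2 .$$ Let $\overline\sigma:[1,\infty)\to(0,\infty)$ be a differentiable decreasing function with $\overline\sigma(j)\le\lambda_j^{1/2}$ for all integers $j\ge1$. With $\kappa$ and $L$ as defined in the context, let $\zeta:\mathbb{R}_+\to\mathbb{N}$ be a function such that $\varepsilon\kappa(\zeta(\varepsilon))\le1$ for $0<\varepsilon<(\kappa(1))^{-1}$. Then for all $0<\varepsilon<(\kappa(1))^{-1}$, $$\nu(S_\varepsilon)\le C(\alpha,\lambda_1)\exp\Big\{-L(\zeta(\varepsilon))-\frac{2-\alpha}{2\alpha}\log\zeta(\varepsilon)-\log\varepsilon\Big\},$$ and, if $\log\overline\sigma(x)$ is convex, then $$\nu(S_\varepsilon)\le C(\alpha,\lambda_1)\exp\Big\{-L(\zeta(\varepsilon))-\frac1{2\alpha}\log\big(\varepsilon^\alpha\zeta(\varepsilon)\big)\Big\}.$$ Here $C(\alpha,\lambda_1)$ denotes finite positive constants (possibly different in each inequality) depending only on $\alpha$ and $\lambda_1$.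
   Context: $\ell_2$ is the real separable Hilbert space of square-summable sequences with scalar product $(x,y)=\sum_i x_iy_i$ and norm $\|x\|$. The characteristic function of a probability measure $\nu$ on $\ell_2$ is $\widehat\nu(y)=\int e^{i(x,y)}\nu(dx)$. For $r>0$, $S_r=\{x\in\ell_2:\|x\|\le r\}$. $\mathbb{N}$ is the set of positive integers. Set $$\kappa(x)=\Big(\frac2\alpha\Big)^{1/\alpha}x^{(1-\alpha)/\alpha}\,(\overline\sigma(x))^{-1},\quad x\ge1,\qquad L(y)=\int_1^y\frac{x\kappa'(x)}{\kappa(x)}\,dx .$$ *)

theory Defs
  imports "HOL-Probability.Probability"
begin

typedef ell2 = "{x :: nat \<Rightarrow> real. summable (\<lambda>i. (x i)\<^sup>2)}"
  morphisms coord Abs_ell2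
  by (rule exI[of _ "\<lambda>_. 0"]) simp

setup_lifting type_definition_ell2

lemma summable_coord_sq: "summable (\<lambda>i. (coord x i)\<^sup>2)"
  using coord[of x] by simp

lemma summable_mult_of_sq:
  fixes x y :: "nat \<Rightarrow> real"
  assumes "summable (\<lambda>i. (x i)\<^sup>2)" "summable (\<lambda>i. (y i)\<^sup>2)"
  shows "summable (\<lambda>i. x i * y i)"
proof (rule summable_comparison_test')
  show "summable (\<lambda>i. (x i)\<^sup>2 + (y i)\<^sup>2)"
    by (rule summable_add[OF assms])
  show "norm (x i * y i) \<le> (x i)\<^sup>2 + (y i)\<^sup>2" if "i \<ge> 0" for i
  proof -
    have "2 * (\<bar>x i\<bar> * \<bar>y i\<bar>) \<le> \<bar>x i\<bar>\<^sup>2 + \<bar>y i\<bar>\<^sup>2"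
      using sum_squares_bound[of "\<bar>x i\<bar>" "\<bar>y i\<bar>"] by (simp add: mult.assoc)
    moreover have "0 \<le> \<bar>x i\<bar> * \<bar>y i\<bar>" by simp
    ultimately show ?thesis
      by (simp only: real_norm_def abs_mult power2_abs)
  qed
qed

lemma summable_add_sq:
  fixes x y :: "nat \<Rightarrow> real"
  assumes "summable (\<lambda>i. (x i)\<^sup>2)" "summable (\<lambda>i. (y i)\<^sup>2)"
  shows "summable (\<lambda>i. (x i + y i)\<^sup>2)"
  unfolding power2_sum
  by (intro summable_add assms)
     (use summable_mult[OF summable_mult_of_sq[OF assms], of 2] in \<open>simp add: mult.assoc\<close>)

lemma summable_scale_sq:
  fixes x :: "nat \<Rightarrow> real"
  assumes "summable (\<lambda>i. (x i)\<^sup>2)"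
  shows "summable (\<lambda>i. (c * x i)\<^sup>2)"
  unfolding power_mult_distrib by (intro summable_mult assms)

instantiation ell2 :: real_vector
begin

lift_definition zero_ell2 :: ell2 is "\<lambda>_. 0" by simp

lift_definition uminus_ell2 :: "ell2 \<Rightarrow> ell2" is "\<lambda>x i. - x i" by simp

lift_definition plus_ell2 :: "ell2 \<Rightarrow> ell2 \<Rightarrow> ell2" is "\<lambda>x y i. x i + y i"
  by (rule summable_add_sq)

lift_definition minus_ell2 :: "ell2 \<Rightarrow> ell2 \<Rightarrow> ell2" is "\<lambda>x y i. x i - y i"
  subgoal for x y using summable_add_sq[of x "\<lambda>i. - y i"] by simp
  done

lift_definition scaleR_ell2 :: "real \<Rightarrow> ell2 \<Rightarrow> ell2" is "\<lambda>c x i. c * x i"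
  by (rule summable_scale_sq)

instance
  by standard (transfer; simp add: fun_eq_iff algebra_simps)+

end

instantiation ell2 :: real_inner
begin

definition inner_ell2 :: "ell2 \<Rightarrow> ell2 \<Rightarrow> real"
  where "inner_ell2 x y = (\<Sum>i. coord x i * coord y i)"

definition norm_ell2 :: "ell2 \<Rightarrow> real"
  where "norm_ell2 x = sqrt (x \<bullet> x)"

definition sgn_ell2 :: "ell2 \<Rightarrow> ell2"
  where "sgn_ell2 x = x /\<^sub>R norm x"

definition dist_ell2 :: "ell2 \<Rightarrow> ell2 \<Rightarrow> real"
  where "dist_ell2 x y = norm (x - y)"

definition uniformity_ell2 :: "(ell2 \<times> ell2) filter"
  where "uniformity_ell2 = (INF e\<in>{0<..}. principal {(x, y). dist x y < e})"

definition open_ell2 :: "ell2 set \<Rightarrow> bool"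
  where "open_ell2 U =
    (\<forall>x\<in>U. eventually (\<lambda>(x', y). x' = x \<longrightarrow> y \<in> U) uniformity)"

instance
proof
  fix x y z :: ell2 and r :: real
  have prod: "summable (\<lambda>i. coord u i * coord v i)" for u v
    by (rule summable_mult_of_sq[OF summable_coord_sq summable_coord_sq])
  show "x \<bullet> y = y \<bullet> x"
    by (simp add: inner_ell2_def mult.commute)
  show "(x + y) \<bullet> z = x \<bullet> z + y \<bullet> z"
    by (simp add: inner_ell2_def plus_ell2.rep_eq distrib_right suminf_add prod)
  show "(r *\<^sub>R x) \<bullet> y = r * (x \<bullet> y)"
    by (simp add: inner_ell2_def scaleR_ell2.rep_eq suminf_mult prod mult.assoc)
  show "0 \<le> x \<bullet> x"
    by (simp add: inner_ell2_def suminf_nonneg prod)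
  show "x \<bullet> x = 0 \<longleftrightarrow> x = 0"
    using suminf_eq_zero_iff[OF prod[of x x]]
    by (auto simp: inner_ell2_def coord_inject[symmetric] zero_ell2.rep_eq fun_eq_iff)
qed (auto simp: norm_ell2_def sgn_ell2_def dist_ell2_def uniformity_ell2_def open_ell2_def)

end

text \<open>The library's \<open>char\<close> covers measures on the real line only.\<close>

definition charf :: "'a::real_inner measure \<Rightarrow> 'a \<Rightarrow> complex"
  where "charf M y = (CLINT x|M. iexp (x \<bullet> y))"

definition kappa :: "real \<Rightarrow> (real \<Rightarrow> real) \<Rightarrow> real \<Rightarrow> real"
  where "kappa \<alpha> \<sigma> x =
    (2 / \<alpha>) powr (1 / \<alpha>) * x powr ((1 - \<alpha>) / \<alpha>) * inverse (\<sigma> x)"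

text \<open>As \<open>\<sigma>\<close> is only meaningful on \<open>[1, \<infinity>)\<close>, the derivative at the left endpoint is one-sided.\<close>

definition L :: "real \<Rightarrow> (real \<Rightarrow> real) \<Rightarrow> real \<Rightarrow> real"
  where "L \<alpha> \<sigma> y =
    integral {1..y} (\<lambda>x. x * vector_derivative (kappa \<alpha> \<sigma>) (at x within {1..}) / kappa \<alpha> \<sigma> x)"

end

theory Submission
  imports Defs
begin

text \<open>
  The proof compares \<open>\<nu>\<close> with its finite-dimensional projections. The ball of radius \<open>\<epsilon>\<close> is contained in the
  cylinder over the \<open>n\<close>-dimensional ball of that radius, and the density of the first \<open>n\<close>
  coordinates is at most \<open>(2 \<pi>)\<^sup>-\<^sup>n\<close> times the integral of their characteristic function. This
  integral is explicit, because the characteristic function is a function of a quadratic form.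
  With \<open>\<omega> = unit_ball_vol n\<close> the result (\<open>stable_ball_le\<close>) is
  \<open>\<nu>(S\<^sub>\<epsilon>) \<le> \<epsilon>\<^sup>n \<omega>\<^sup>2 (2 \<pi>)\<^sup>-\<^sup>n 2 powr (n / \<alpha>) Gamma (n / \<alpha> + 1) / (\<Prod>i<n. sqrt (lam i))\<close>
  for every \<open>n\<close>.

  Stirling's approximation and the lower bound \<open>\<sigma>\<close> of the \<open>sqrt (lam i)\<close> bound the right side by a constant times
  \<open>\<epsilon>\<^sup>n n powr (- 1 / (2 \<alpha>)) \<kappa>(1) \<dots> \<kappa>(n)\<close> (\<open>ball_gamma_factor_bound\<close>). Up to the
  power of \<open>n\<close>, the \<open>n\<close>-th coordinate thus multiplies the bound by \<open>\<epsilon> \<kappa>(n)\<close>, and the condition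
  \<open>\<epsilon> \<kappa>(n) \<le> 1\<close> says that the last coordinate in use does not make it worse.
  On the other hand, integration by parts (\<open>L_eq\<close>) gives
  \<open>- L(n) = - n ln \<kappa>(n) + ln \<kappa>(1) + \<integral>\<^sub>1\<^sup>n ln \<kappa>\<close>, and \<open>n ln \<epsilon> \<le> - n ln \<kappa>(n)\<close>. With \<open>n = \<zeta>(\<epsilon>)\<close> what
  remains is the difference of the sum and the integral of \<open>ln \<kappa>\<close>, that is, of \<open>- ln \<sigma>\<close>
  up to terms handled by Stirling's approximation again. If \<open>\<sigma>\<close> is decreasing, a Riemann sum leaves
  one extra term \<open>ln \<kappa>(n) \<le> - ln \<epsilon>\<close>; if \<open>ln \<sigma>\<close> is convex, the trapezoidal rule leaves
  only half of it. The two inequalities of the theorem are these two cases.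
\<close>

section \<open>Lebesgue measure on finite products\<close>

interpretation lborel_product: product_sigma_finite "\<lambda>_::'i. lborel :: real measure"
  by standard

text \<open>
  Coordinatewise affine substitution in Lebesgue measure on the functions \<open>I \<rightarrow> \<real>\<close>. Working on a
  product measure over an index set, and not on a Euclidean space type, lets the dimension
  be a number; it has to depend on \<open>\<epsilon>\<close> later. The two sides agree on boxes by the
  one-dimensional rule, and boxes determine a product measure.
\<close>
lemma nn_integral_PiM_lborel_affine:
  fixes c t :: "'i \<Rightarrow> real"
  assumes I: "finite I" and c: "\<And>i. i \<in> I \<Longrightarrow> c i \<noteq> 0"
    and [measurable]: "f \<in> borel_measurable (Pi\<^sub>M I (\<lambda>_. lborel))"
  shows "(\<integral>\<^sup>+x. f x \<partial>Pi\<^sub>M I (\<lambda>_. lborel)) =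
    ennreal (\<Prod>i\<in>I. \<bar>c i\<bar>) * (\<integral>\<^sup>+x. f (\<lambda>i\<in>I. t i + c i * x i) \<partial>Pi\<^sub>M I (\<lambda>_. lborel))"
proof -
  let ?P = "Pi\<^sub>M I (\<lambda>_. lborel :: real measure)"
  let ?T = "\<lambda>x. \<lambda>i\<in>I. t i + c i * x i"
  let ?k = "ennreal (\<Prod>i\<in>I. \<bar>c i\<bar>)"
  have [measurable]: "?T \<in> measurable ?P ?P"
    by (rule measurable_restrict) measurable
  have "density (distr ?P ?P ?T) (\<lambda>_. ?k) = ?P"
  proof (rule lborel_product.PiM_eqI[OF I])
    fix A :: "'i \<Rightarrow> real set"
    assume A: "\<And>i. i \<in> I \<Longrightarrow> A i \<in> sets lborel"
    define A' where "A' i = (\<lambda>x. t i + c i * x) -` A i" for i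
    have A': "A' i \<in> sets lborel" if "i \<in> I" for i
    proof -
      have "(\<lambda>x. t i + c i * x) -` A i \<inter> space borel \<in> sets borel"
        using A[OF that] by (intro measurable_sets[of _ borel borel]) auto
      then show ?thesis by (simp add: A'_def)
    qed
    have one: "emeasure lborel (A i) = ennreal \<bar>c i\<bar> * emeasure lborel (A' i)" if "i \<in> I" for i
    proof -
      have "emeasure lborel (A i) = (\<integral>\<^sup>+x. indicator (A i) x \<partial>lborel)"
        using A[OF that] by simp
      also have "\<dots> = ennreal \<bar>c i\<bar> * (\<integral>\<^sup>+x. indicator (A i) (t i + c i * x) \<partial>lborel)"
        using A[OF that] c[OF that] by (intro nn_integral_real_affine) auto
      also have "(\<lambda>x. indicator (A i) (t i + c i * x) :: ennreal) = indicator (A' i)"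
        by (auto simp: A'_def indicator_def)
      finally show ?thesis using A'[OF that] by simp
    qed
    have vim: "?T -` (Pi\<^sub>E I A) \<inter> space ?P = Pi\<^sub>E I A'"
      by (auto simp: A'_def space_PiM PiE_iff)
    have PA: "Pi\<^sub>E I A \<in> sets ?P" using A I by (intro sets_PiM_I_finite) auto
    have "emeasure (density (distr ?P ?P ?T) (\<lambda>_. ?k)) (Pi\<^sub>E I A) = ?k * emeasure (distr ?P ?P ?T) (Pi\<^sub>E I A)"
      using PA by (simp add: emeasure_density nn_integral_cmult)
    also have "emeasure (distr ?P ?P ?T) (Pi\<^sub>E I A) = emeasure ?P (Pi\<^sub>E I A')"
      using PA by (subst emeasure_distr) (auto simp: vim)
    also have "\<dots> = (\<Prod>i\<in>I. emeasure lborel (A' i))"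
      using A' by (intro lborel_product.emeasure_PiM I) auto
    also have "?k * \<dots> = (\<Prod>i\<in>I. ennreal \<bar>c i\<bar> * emeasure lborel (A' i))"
      by (simp add: prod.distrib prod_ennreal)
    also have "\<dots> = (\<Prod>i\<in>I. emeasure lborel (A i))" using one by simp
    finally show "emeasure (density (distr ?P ?P ?T) (\<lambda>_. ?k)) (Pi\<^sub>E I A) = (\<Prod>i\<in>I. emeasure lborel (A i))" .
  qed simp
  then have "(\<integral>\<^sup>+x. f x \<partial>?P) = (\<integral>\<^sup>+x. f x \<partial>density (distr ?P ?P ?T) (\<lambda>_. ?k))" by simp
  also have "\<dots> = ?k * (\<integral>\<^sup>+x. f (?T x) \<partial>?P)"
    by (simp add: nn_integral_density nn_integral_cmult nn_integral_distr)
  finally show ?thesis .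
qed

lemma emeasure_PiM_lborel_ellipsoid:
  fixes a :: "'i \<Rightarrow> real"
  assumes I: "finite I" and a: "\<And>i. i \<in> I \<Longrightarrow> 0 < a i" and r: "0 < r"
  shows "emeasure (Pi\<^sub>M I (\<lambda>_. lborel)) {x \<in> space (Pi\<^sub>M I (\<lambda>_. lborel)). sqrt (\<Sum>i\<in>I. a i * (x i)\<^sup>2) \<le> r} =
    ennreal (unit_ball_vol (real (card I)) * r ^ card I / (\<Prod>i\<in>I. sqrt (a i)))"
proof -
  let ?P = "Pi\<^sub>M I (\<lambda>_. lborel :: real measure)"
  define B where "B = {f. sqrt (\<Sum>i\<in>I. (f i)\<^sup>2) \<le> r} \<inter> space ?P"
  define E where "E = {x \<in> space ?P. sqrt (\<Sum>i\<in>I. a i * (x i)\<^sup>2) \<le> r}"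
  have [measurable]: "B \<in> sets ?P"
  proof -
    have "B = {f \<in> space ?P. sqrt (\<Sum>i\<in>I. (f i)\<^sup>2) \<le> r}" by (auto simp: B_def)
    then show ?thesis using I by simp
  qed
  have [measurable]: "E \<in> sets ?P" unfolding E_def using I by simp
  define p where "p = (\<Prod>i\<in>I. sqrt (a i))"
  have p: "p > 0" unfolding p_def using a by (intro prod_pos) auto
  have "emeasure ?P B = (\<integral>\<^sup>+x. indicator B x \<partial>?P)" by simp
  also have "\<dots> = ennreal (\<Prod>i\<in>I. \<bar>sqrt (a i)\<bar>) * (\<integral>\<^sup>+x. indicator B (\<lambda>i\<in>I. 0 + sqrt (a i) * x i) \<partial>?P)"
    using a by (intro nn_integral_PiM_lborel_affine I) (auto simp: less_le)
  also have "(\<Prod>i\<in>I. \<bar>sqrt (a i)\<bar>) = p" unfolding p_def using a by (intro prod.cong) (auto simp: less_imp_le)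
  also have "(\<integral>\<^sup>+x. indicator B (\<lambda>i\<in>I. 0 + sqrt (a i) * x i) \<partial>?P) = (\<integral>\<^sup>+x. indicator E x \<partial>?P)"
  proof (rule nn_integral_cong)
    fix x assume x: "x \<in> space ?P"
    have "(\<Sum>i\<in>I. (sqrt (a i) * x i)\<^sup>2) = (\<Sum>i\<in>I. a i * (x i)\<^sup>2)"
      using a by (intro sum.cong) (auto simp: power_mult_distrib less_imp_le)
    then show "(indicator B (\<lambda>i\<in>I. 0 + sqrt (a i) * x i) :: ennreal) = indicator E x"
      using x by (auto simp: B_def E_def indicator_def space_PiM)
  qed
  also have "\<dots> = emeasure ?P E" by simp
  finally have "ennreal p * emeasure ?P E = ennreal (unit_ball_vol (real (card I)) * r ^ card I)"
    unfolding B_def using emeasure_cball_aux[OF I r] by simp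
  moreover have "ennreal (1 / p) * (ennreal p * emeasure ?P E) = emeasure ?P E"
    using p by (simp add: mult.assoc[symmetric] ennreal_mult'[symmetric])
  ultimately have "emeasure ?P E = ennreal (1 / p) * ennreal (unit_ball_vol (real (card I)) * r ^ card I)"
    by simp
  also have "\<dots> = ennreal (unit_ball_vol (real (card I)) * r ^ card I / p)"
    using p r by (subst ennreal_mult'[symmetric]) auto
  finally show ?thesis unfolding E_def p_def .
qed

section \<open>Ball probabilities and characteristic functions\<close>

text \<open>
  Fourier inversion for the centred normal density. It follows from the known characteristic
  function of the standard normal law, because that function is again a Gaussian: read with
  the roles of the two variables exchanged, and rescaled, it is an inversion formula.
\<close>
lemma normal_density_conv_fourier:
  fixes \<delta> u :: real
  assumes \<delta>: "0 < \<delta>"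
  shows "complex_of_real (normal_density 0 \<delta> u) =
    (CLINT y|lborel. complex_of_real (1 / (2 * pi)) * (iexp (u * y) * exp (- (\<delta>\<^sup>2 * y\<^sup>2 / 2))))"
proof -
  have "complex_of_real (exp (- ((u / \<delta>)\<^sup>2) / 2)) = (CLINT x|density lborel std_normal_density. iexp (u / \<delta> * x))"
    using fun_cong[OF char_std_normal_distribution, of "u / \<delta>"] by (simp add: char_def)
  also have "\<dots> = (CLINT x|lborel. std_normal_density x *\<^sub>R iexp (u / \<delta> * x))"
    by (intro integral_density) auto
  also have "\<dots> = \<delta> *\<^sub>R (CLINT x|lborel. std_normal_density (0 + \<delta> * x) *\<^sub>R iexp (u / \<delta> * (0 + \<delta> * x)))"
    using \<delta> by (subst lborel_integral_real_affine[of \<delta> _ 0]) auto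
  finally have eq: "complex_of_real (exp (- ((u / \<delta>)\<^sup>2) / 2)) =
     \<delta> *\<^sub>R (CLINT x|lborel. std_normal_density (0 + \<delta> * x) *\<^sub>R iexp (u / \<delta> * (0 + \<delta> * x)))" .
  have "complex_of_real (normal_density 0 \<delta> u) = (1 / (sqrt (2 * pi) * \<delta>)) *\<^sub>R complex_of_real (exp (- ((u / \<delta>)\<^sup>2) / 2))"
    using \<delta> by (simp add: normal_density_def real_sqrt_mult power_divide scaleR_conv_of_real)
  also have "\<dots> = (1 / sqrt (2 * pi)) *\<^sub>R (CLINT x|lborel. std_normal_density (0 + \<delta> * x) *\<^sub>R iexp (u / \<delta> * (0 + \<delta> * x)))"
    unfolding eq using \<delta> by simp
  also have "\<dots> = (CLINT x|lborel. (1 / sqrt (2 * pi)) *\<^sub>R std_normal_density (0 + \<delta> * x) *\<^sub>R iexp (u / \<delta> * (0 + \<delta> * x)))"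
    by (rule integral_scaleR_right[symmetric])
  also have "\<dots> = (CLINT y|lborel. complex_of_real (1 / (2 * pi)) * (iexp (u * y) * exp (- (\<delta>\<^sup>2 * y\<^sup>2 / 2))))"
  proof (rule Bochner_Integration.integral_cong[OF refl])
    fix x :: real
    have "sqrt (2 * pi) * sqrt (2 * pi) = 2 * pi" by simp
    then have "(1 / sqrt (2 * pi)) * std_normal_density (0 + \<delta> * x) = 1 / (2 * pi) * exp (- (\<delta>\<^sup>2 * x\<^sup>2 / 2))"
      by (simp add: std_normal_density_def power_mult_distrib)
    moreover have "u / \<delta> * (0 + \<delta> * x) = u * x" using \<delta> by simp
    ultimately show "(1 / sqrt (2 * pi)) *\<^sub>R std_normal_density (0 + \<delta> * x) *\<^sub>R iexp (u / \<delta> * (0 + \<delta> * x)) =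
       complex_of_real (1 / (2 * pi)) * (iexp (u * x) * exp (- (\<delta>\<^sup>2 * x\<^sup>2 / 2)))"
      by (simp only: scaleR_scaleR) (simp add: scaleR_conv_of_real exp_of_real[symmetric] mult_ac)
  qed
  finally show ?thesis .
qed

lemma integrable_exp_square:
  assumes "0 < (\<delta>::real)"
  shows "integrable lborel (\<lambda>x::real. exp (- (\<delta>\<^sup>2 * x\<^sup>2 / 2)))"
proof -
  have "(\<lambda>x. exp (- (\<delta>\<^sup>2 * x\<^sup>2 / 2))) = (\<lambda>x. sqrt (2 * pi * (1 / \<delta>)\<^sup>2) * normal_density 0 (1 / \<delta>) x)"
    using assms by (auto simp: normal_density_def power_divide field_simps)
  moreover have "integrable lborel (\<lambda>x. sqrt (2 * pi * (1 / \<delta>)\<^sup>2) * normal_density 0 (1 / \<delta>) x)"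
    using assms by auto
  ultimately show ?thesis by simp
qed

lemma prod_normal_density_conv_fourier:
  fixes u :: "'i \<Rightarrow> real"
  assumes I: "finite I" and \<delta>: "0 < \<delta>"
  shows "complex_of_real (\<Prod>i\<in>I. normal_density 0 \<delta> (u i)) =
    complex_of_real ((1 / (2 * pi)) ^ card I) *
    (CLINT y|Pi\<^sub>M I (\<lambda>_. lborel). iexp (\<Sum>i\<in>I. u i * y i) * complex_of_real (\<Prod>i\<in>I. exp (- (\<delta>\<^sup>2 * (y i)\<^sup>2 / 2))))"
proof -
  let ?g = "\<lambda>i y. complex_of_real (1 / (2 * pi)) * (iexp (u i * y) * exp (- (\<delta>\<^sup>2 * y\<^sup>2 / 2)))"
  have int: "integrable lborel (?g i)" for i
  proof (intro integrable_mult_right Bochner_Integration.integrable_bound[OF integrable_exp_square[OF \<delta>]])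
    show "AE x in lborel. norm (iexp (u i * x) * complex_of_real (exp (- (\<delta>\<^sup>2 * x\<^sup>2 / 2)))) \<le> norm (exp (- (\<delta>\<^sup>2 * x\<^sup>2 / 2)))"
      by (simp add: norm_mult del: of_real_mult)
  qed measurable
  have "complex_of_real (\<Prod>i\<in>I. normal_density 0 \<delta> (u i)) = (\<Prod>i\<in>I. (CLINT y|lborel. ?g i y))"
    unfolding of_real_prod by (intro prod.cong refl normal_density_conv_fourier \<delta>)
  also have "\<dots> = (CLINT y|Pi\<^sub>M I (\<lambda>_. lborel). (\<Prod>i\<in>I. ?g i (y i)))"
    by (rule lborel_product.product_integral_prod[symmetric, OF I int])
  also have "\<dots> = (CLINT y|Pi\<^sub>M I (\<lambda>_. lborel). complex_of_real ((1 / (2 * pi)) ^ card I) *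
      (iexp (\<Sum>i\<in>I. u i * y i) * complex_of_real (\<Prod>i\<in>I. exp (- (\<delta>\<^sup>2 * (y i)\<^sup>2 / 2)))))"
    using I by (intro Bochner_Integration.integral_cong refl)
      (simp add: prod.distrib exp_sum sum_distrib_left prod_dividef power_divide)
  finally show ?thesis by simp
qed

text \<open>
  The left side is the density at \<open>z\<close> of the law of \<open>X + \<delta> G\<close> with \<open>G\<close> standard normal and
  independent of \<open>X\<close>. Inserting the Fourier representation of the Gaussian kernel and
  exchanging the integrals turns it into the Fourier integral of the characteristic function
  of \<open>X\<close> times a Gaussian factor of modulus at most 1. That factor makes the exchange
  legitimate and then disappears from the bound, which is therefore uniform in \<open>\<delta>\<close>.
\<close>
lemma (in prob_space) smoothed_density_le:
  fixes X :: "'i \<Rightarrow> 'a \<Rightarrow> real"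
  assumes I: "finite I" and \<delta>: "0 < \<delta>"
    and X[measurable]: "\<And>i. i \<in> I \<Longrightarrow> X i \<in> borel_measurable M"
    and int: "integrable (Pi\<^sub>M I (\<lambda>_. lborel)) (\<lambda>y. norm (CLINT \<omega>|M. iexp (\<Sum>i\<in>I. X i \<omega> * y i)))"
  shows "(LINT \<omega>|M. (\<Prod>i\<in>I. normal_density 0 \<delta> (X i \<omega> - z i))) \<le>
    (1 / (2 * pi)) ^ card I * (LINT y|Pi\<^sub>M I (\<lambda>_. lborel). norm (CLINT \<omega>|M. iexp (\<Sum>i\<in>I. X i \<omega> * y i)))"
proof -
  let ?P = "Pi\<^sub>M I (\<lambda>_. lborel :: real measure)"
  let ?c = "(1 / (2 * pi)) ^ card I"
  define E where "E = (\<lambda>y. \<Prod>i\<in>I. exp (- (\<delta>\<^sup>2 * (y i)\<^sup>2 / 2)))"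
  define \<phi> where "\<phi> = (\<lambda>y. CLINT \<omega>|M. iexp (\<Sum>i\<in>I. X i \<omega> * y i))"
  have E0: "0 \<le> E y" "E y \<le> 1" for y unfolding E_def by (auto intro!: prod_nonneg prod_le_1)
  have intE: "integrable ?P E" unfolding E_def
    by (intro lborel_product.product_integrable_prod I integrable_exp_square \<delta>)
  have [measurable]: "E \<in> borel_measurable ?P" using intE by auto
  interpret PI: finite_product_sigma_finite "\<lambda>_. lborel :: real measure" I by standard fact
  interpret pair_sigma_finite M ?P by standard
  let ?h = "\<lambda>(\<omega>, y). iexp (\<Sum>i\<in>I. (X i \<omega> - z i) * y i) * complex_of_real (E y)"
  have [measurable]: "?h \<in> borel_measurable (M \<Otimes>\<^sub>M ?P)"
    using I by measurable
  have inth: "integrable (M \<Otimes>\<^sub>M ?P) ?h"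
  proof (rule integrableI_bounded)
    have "(\<integral>\<^sup>+ p. ennreal (norm (?h p)) \<partial>(M \<Otimes>\<^sub>M ?P)) = (\<integral>\<^sup>+ p. ennreal (E (snd p)) \<partial>(M \<Otimes>\<^sub>M ?P))"
      using E0 by (intro nn_integral_cong) (auto simp: norm_mult split: prod.splits)
    also have "\<dots> = (\<integral>\<^sup>+ \<omega>. \<integral>\<^sup>+ y. ennreal (E y) \<partial>?P \<partial>M)"
      using PI.nn_integral_fst[of "\<lambda>p. ennreal (E (snd p))" M] by simp
    also have "\<dots> = (\<integral>\<^sup>+ y. ennreal (E y) \<partial>?P)" by (simp add: emeasure_space_1)
    also have "\<dots> < \<infinity>" using intE E0 by (simp add: integrable_iff_bounded)
    finally show "(\<integral>\<^sup>+ p. ennreal (norm (?h p)) \<partial>(M \<Otimes>\<^sub>M ?P)) < \<infinity>" .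
  qed simp
  have inner: "(CLINT \<omega>|M. iexp (\<Sum>i\<in>I. (X i \<omega> - z i) * y i) * complex_of_real (E y)) =
      iexp (- (\<Sum>i\<in>I. z i * y i)) * complex_of_real (E y) * \<phi> y" for y
  proof -
    have "iexp (\<Sum>i\<in>I. (X i \<omega> - z i) * y i) * complex_of_real (E y) =
      iexp (- (\<Sum>i\<in>I. z i * y i)) * complex_of_real (E y) * iexp (\<Sum>i\<in>I. X i \<omega> * y i)" for \<omega>
      by (simp add: left_diff_distrib sum_subtractf exp_diff exp_minus right_diff_distrib field_simps)
    then show ?thesis unfolding \<phi>_def by (simp only: integral_mult_right_zero)
  qed
  have "complex_of_real (LINT \<omega>|M. (\<Prod>i\<in>I. normal_density 0 \<delta> (X i \<omega> - z i))) =
    (CLINT \<omega>|M. complex_of_real (\<Prod>i\<in>I. normal_density 0 \<delta> (X i \<omega> - z i)))"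
    by (rule integral_complex_of_real[symmetric])
  also have "\<dots> = (CLINT \<omega>|M. complex_of_real ?c * (CLINT y|?P. iexp (\<Sum>i\<in>I. (X i \<omega> - z i) * y i) * complex_of_real (E y)))"
    by (simp only: prod_normal_density_conv_fourier[OF I \<delta>] E_def)
  also have "\<dots> = complex_of_real ?c * (CLINT \<omega>|M. CLINT y|?P. iexp (\<Sum>i\<in>I. (X i \<omega> - z i) * y i) * complex_of_real (E y))"
    by (rule integral_mult_right_zero)
  also have "(CLINT \<omega>|M. CLINT y|?P. iexp (\<Sum>i\<in>I. (X i \<omega> - z i) * y i) * complex_of_real (E y)) =
    (CLINT y|?P. CLINT \<omega>|M. iexp (\<Sum>i\<in>I. (X i \<omega> - z i) * y i) * complex_of_real (E y))"
    using inth by (intro Fubini_integral[symmetric]) auto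
  also have "\<dots> = (CLINT y|?P. iexp (- (\<Sum>i\<in>I. z i * y i)) * complex_of_real (E y) * \<phi> y)"
    by (simp only: inner)
  finally have eq: "complex_of_real (LINT \<omega>|M. (\<Prod>i\<in>I. normal_density 0 \<delta> (X i \<omega> - z i))) =
    complex_of_real ?c * (CLINT y|?P. iexp (- (\<Sum>i\<in>I. z i * y i)) * complex_of_real (E y) * \<phi> y)" .
  have "(LINT \<omega>|M. (\<Prod>i\<in>I. normal_density 0 \<delta> (X i \<omega> - z i))) \<le> norm (complex_of_real (LINT \<omega>|M. (\<Prod>i\<in>I. normal_density 0 \<delta> (X i \<omega> - z i))))"
    by simp
  also have "\<dots> = ?c * norm (CLINT y|?P. iexp (- (\<Sum>i\<in>I. z i * y i)) * complex_of_real (E y) * \<phi> y)"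
    unfolding eq by (simp add: norm_mult norm_power norm_divide)
  also have "\<dots> \<le> ?c * (LINT y|?P. norm (\<phi> y))"
  proof (intro mult_left_mono)
    have "norm (CLINT y|?P. iexp (- (\<Sum>i\<in>I. z i * y i)) * complex_of_real (E y) * \<phi> y) \<le>
      (LINT y|?P. norm (iexp (- (\<Sum>i\<in>I. z i * y i)) * complex_of_real (E y) * \<phi> y))"
      by (rule integral_norm_bound)
    also have "\<dots> \<le> (LINT y|?P. norm (\<phi> y))"
    proof (rule integral_mono')
      show "integrable ?P (\<lambda>y. norm (\<phi> y))" using int by (simp add: \<phi>_def)
      show "norm (iexp (- (\<Sum>i\<in>I. z i * y i)) * complex_of_real (E y) * \<phi> y) \<le> norm (\<phi> y)" for y
        using E0[of y] by (simp add: norm_mult mult_left_le_one_le)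
    qed simp
    finally show "norm (CLINT y|?P. iexp (- (\<Sum>i\<in>I. z i * y i)) * complex_of_real (E y) * \<phi> y) \<le> (LINT y|?P. norm (\<phi> y))" .
  qed simp
  finally show ?thesis unfolding \<phi>_def .
qed

text \<open>
  If \<open>X\<close> lies in the ball of radius \<open>r\<close> and the perturbation \<open>\<delta> G\<close> has norm at most \<open>\<eta>\<close>, then
  \<open>X + \<delta> G\<close> lies in the ball of radius \<open>r + \<eta>\<close>, whose probability is at most its volume times
  the density bound. By independence the first two events have probability
  \<open>P(|X| \<le> r) P(|G| \<le> \<eta> / \<delta>)\<close>. Letting first \<open>\<delta>\<close> and then \<open>\<eta>\<close> tend to 0 gives the claim
  without constructing a density of \<open>X\<close> itself.

  The constant matters. A Gaussian majorant of the indicator of the ball would give a bound that is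
  larger by a factor of order \<open>sqrt (card I)\<close>, too large for the powers of \<open>\<zeta>(\<epsilon>)\<close> in the theorem.
\<close>
lemma (in prob_space) prob_ball_le_integral_char:
  fixes X :: "'i \<Rightarrow> 'a \<Rightarrow> real"
  assumes I: "finite I" and r: "0 < r"
    and X[measurable]: "\<And>i. i \<in> I \<Longrightarrow> X i \<in> borel_measurable M"
    and int: "integrable (Pi\<^sub>M I (\<lambda>_. lborel)) (\<lambda>y. norm (CLINT \<omega>|M. iexp (\<Sum>i\<in>I. X i \<omega> * y i)))"
  shows "prob {\<omega>\<in>space M. sqrt (\<Sum>i\<in>I. (X i \<omega>)\<^sup>2) \<le> r} \<le>
    unit_ball_vol (real (card I)) * r ^ card I * (1 / (2 * pi)) ^ card I *
    (LINT y|Pi\<^sub>M I (\<lambda>_. lborel). norm (CLINT \<omega>|M. iexp (\<Sum>i\<in>I. X i \<omega> * y i)))"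
    (is "prob ?B \<le> _ * _ * ?c * ?K")
proof -
  let ?P = "Pi\<^sub>M I (\<lambda>_. lborel :: real measure)"
  let ?n = "card I"
  interpret PI: finite_product_sigma_finite "\<lambda>_. lborel :: real measure" I by standard fact
  interpret pair_sigma_finite M ?P by standard
  define G where "G = (\<lambda>g. \<Prod>i\<in>I. normal_density 0 1 (g i :: real))"
  have G0: "0 \<le> G g" for g unfolding G_def by (auto intro!: prod_nonneg)
  have [measurable]: "G \<in> borel_measurable ?P" unfolding G_def using I by measurable
  have [measurable]: "?B \<in> sets M" using I by measurable
  have K0: "0 \<le> ?K" by simp
  have intG: "(\<integral>\<^sup>+g. ennreal (G g) \<partial>?P) = 1"
  proof -
    have "(\<integral>\<^sup>+g. ennreal (G g) \<partial>?P) = (\<integral>\<^sup>+g. (\<Prod>i\<in>I. ennreal (normal_density 0 1 (g i))) \<partial>?P)"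
      unfolding G_def by (simp add: prod_ennreal)
    also have "\<dots> = (\<Prod>i\<in>I. \<integral>\<^sup>+x. ennreal (normal_density 0 1 x) \<partial>lborel)"
      by (rule lborel_product.product_nn_integral_prod[OF I]) auto
    also have "\<dots> = 1"
      using prob_space.emeasure_space_1[OF prob_space_normal_density[of 1 0]]
      by (simp add: emeasure_density)
    finally show ?thesis .
  qed
  define D where "D R = {g \<in> space ?P. sqrt (\<Sum>i\<in>I. (g i)\<^sup>2) \<le> R}" for R
  have [measurable]: "D R \<in> sets ?P" for R unfolding D_def using I by measurable
  have volD: "emeasure ?P (D R) = ennreal (unit_ball_vol (real ?n) * R ^ ?n)" if "R > 0" for R
    using emeasure_PiM_lborel_ellipsoid[OF I, of "\<lambda>_. 1" R] that unfolding D_def by simp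
  (* the integral of G over the ball D is P(|G| <= eta/delta) *)
  have key: "emeasure M ?B * (\<integral>\<^sup>+g. ennreal (G g) * indicator (D (\<eta> / \<delta>)) g \<partial>?P) \<le>
      ennreal (?c * ?K) * emeasure ?P (D (r + \<eta>))" if \<eta>: "\<eta> > 0" and \<delta>: "\<delta> > 0" for \<eta> \<delta>
  proof -
    have "emeasure M ?B * (\<integral>\<^sup>+g. ennreal (G g) * indicator (D (\<eta> / \<delta>)) g \<partial>?P) =
      (\<integral>\<^sup>+\<omega>. indicator ?B \<omega> * (\<integral>\<^sup>+g. ennreal (G g) * indicator (D (\<eta> / \<delta>)) g \<partial>?P) \<partial>M)"
      by (simp add: nn_integral_multc)
    also have "\<dots> \<le> (\<integral>\<^sup>+\<omega>. (\<integral>\<^sup>+g. ennreal (G g) * indicator (D (r + \<eta>)) (\<lambda>i\<in>I. X i \<omega> + \<delta> * g i) \<partial>?P) \<partial>M)"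
    proof (intro nn_integral_mono)
      fix \<omega> assume "\<omega> \<in> space M"
      have "indicator ?B \<omega> * (\<integral>\<^sup>+g. ennreal (G g) * indicator (D (\<eta> / \<delta>)) g \<partial>?P) =
        (\<integral>\<^sup>+g. indicator ?B \<omega> * (ennreal (G g) * indicator (D (\<eta> / \<delta>)) g) \<partial>?P)"
        by (rule nn_integral_cmult[symmetric]) measurable
      also have "\<dots> \<le> (\<integral>\<^sup>+g. ennreal (G g) * indicator (D (r + \<eta>)) (\<lambda>i\<in>I. X i \<omega> + \<delta> * g i) \<partial>?P)"
      proof (intro nn_integral_mono)
        fix g assume g: "g \<in> space ?P"
        have "(\<lambda>i\<in>I. X i \<omega> + \<delta> * g i) \<in> D (r + \<eta>)" if "\<omega> \<in> ?B" "g \<in> D (\<eta> / \<delta>)"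
        proof -
          have "L2_set (\<lambda>i. \<delta> * g i) I = \<delta> * L2_set g I"
            using \<delta> by (simp add: L2_set_right_distrib)
          moreover have "L2_set g I \<le> \<eta> / \<delta>" using that by (simp add: D_def L2_set_def)
          ultimately have "L2_set (\<lambda>i. \<delta> * g i) I \<le> \<eta>" using \<delta> by (simp add: field_simps)
          moreover have "L2_set (\<lambda>i. X i \<omega>) I \<le> r" using that by (simp add: L2_set_def)
          ultimately have "L2_set (\<lambda>i. X i \<omega> + \<delta> * g i) I \<le> r + \<eta>"
            using L2_set_triangle_ineq[of "\<lambda>i. X i \<omega>" "\<lambda>i. \<delta> * g i" I] by linarith
          then show ?thesis by (auto simp: D_def L2_set_def space_PiM)
        qed
        then show "indicator ?B \<omega> * (ennreal (G g) * indicator (D (\<eta> / \<delta>)) g) \<le>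
            ennreal (G g) * indicator (D (r + \<eta>)) (\<lambda>i\<in>I. X i \<omega> + \<delta> * g i)"
          by (auto simp: indicator_def)
      qed
      finally show "indicator ?B \<omega> * (\<integral>\<^sup>+g. ennreal (G g) * indicator (D (\<eta> / \<delta>)) g \<partial>?P) \<le>
         (\<integral>\<^sup>+g. ennreal (G g) * indicator (D (r + \<eta>)) (\<lambda>i\<in>I. X i \<omega> + \<delta> * g i) \<partial>?P)" .
    qed
    (* substitute z = X + delta g, which rescales G to the density of delta G *)
    also have "\<dots> = (\<integral>\<^sup>+\<omega>. (\<integral>\<^sup>+z. ennreal (\<Prod>i\<in>I. normal_density 0 \<delta> (X i \<omega> - z i)) * indicator (D (r + \<eta>)) z \<partial>?P) \<partial>M)"
    proof (rule nn_integral_cong)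
      fix \<omega> assume "\<omega> \<in> space M"
      have "(\<integral>\<^sup>+z. ennreal (\<Prod>i\<in>I. normal_density 0 \<delta> (X i \<omega> - z i)) * indicator (D (r + \<eta>)) z \<partial>?P) =
        ennreal (\<Prod>i\<in>I. \<bar>\<delta>\<bar>) * (\<integral>\<^sup>+g. ennreal (\<Prod>i\<in>I. normal_density 0 \<delta> (X i \<omega> - (\<lambda>i\<in>I. X i \<omega> + \<delta> * g i) i)) *
           indicator (D (r + \<eta>)) (\<lambda>i\<in>I. X i \<omega> + \<delta> * g i) \<partial>?P)"
        using I \<delta> by (intro nn_integral_PiM_lborel_affine) auto
      also have "\<dots> = (\<integral>\<^sup>+g. ennreal (\<Prod>i\<in>I. \<bar>\<delta>\<bar>) * (ennreal (\<Prod>i\<in>I. normal_density 0 \<delta> (X i \<omega> - (\<lambda>i\<in>I. X i \<omega> + \<delta> * g i) i)) *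
           indicator (D (r + \<eta>)) (\<lambda>i\<in>I. X i \<omega> + \<delta> * g i)) \<partial>?P)"
      proof (rule nn_integral_cmult[symmetric])
        have T: "(\<lambda>g. \<lambda>i\<in>I. X i \<omega> + \<delta> * g i) \<in> measurable ?P ?P"
          by (rule measurable_restrict) measurable
        show "(\<lambda>g. ennreal (\<Prod>i\<in>I. normal_density 0 \<delta> (X i \<omega> - (\<lambda>i\<in>I. X i \<omega> + \<delta> * g i) i)) *
           indicator (D (r + \<eta>)) (\<lambda>i\<in>I. X i \<omega> + \<delta> * g i)) \<in> borel_measurable ?P"
        proof (rule measurable_compose[OF T])
          show "(\<lambda>z. ennreal (\<Prod>i\<in>I. normal_density 0 \<delta> (X i \<omega> - z i)) * indicator (D (r + \<eta>)) z) \<in> borel_measurable ?P"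
            using I by measurable
        qed
      qed
      also have "\<dots> = (\<integral>\<^sup>+g. ennreal (G g) * indicator (D (r + \<eta>)) (\<lambda>i\<in>I. X i \<omega> + \<delta> * g i) \<partial>?P)"
      proof (intro nn_integral_cong)
        fix g
        have "\<delta> * normal_density 0 \<delta> (X i \<omega> - (\<lambda>i\<in>I. X i \<omega> + \<delta> * g i) i) = normal_density 0 1 (g i)" if "i \<in> I" for i
          using \<delta> that by (simp add: normal_density_def real_sqrt_mult power_mult_distrib)
        then have "(\<Prod>i\<in>I. \<delta>) * (\<Prod>i\<in>I. normal_density 0 \<delta> (X i \<omega> - (\<lambda>i\<in>I. X i \<omega> + \<delta> * g i) i)) = G g"
          unfolding G_def prod.distrib[symmetric] by (intro prod.cong) auto
        then have "ennreal (\<Prod>i\<in>I. \<bar>\<delta>\<bar>) * ennreal (\<Prod>i\<in>I. normal_density 0 \<delta> (X i \<omega> - (\<lambda>i\<in>I. X i \<omega> + \<delta> * g i) i)) = ennreal (G g)"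
          using \<delta> by (subst ennreal_mult'[symmetric]) (auto intro!: prod_nonneg)
        then show "ennreal (\<Prod>i\<in>I. \<bar>\<delta>\<bar>) * (ennreal (\<Prod>i\<in>I. normal_density 0 \<delta> (X i \<omega> - (\<lambda>i\<in>I. X i \<omega> + \<delta> * g i) i)) *
           indicator (D (r + \<eta>)) (\<lambda>i\<in>I. X i \<omega> + \<delta> * g i)) = ennreal (G g) * indicator (D (r + \<eta>)) (\<lambda>i\<in>I. X i \<omega> + \<delta> * g i)"
          by (simp add: mult.assoc[symmetric])
      qed
      finally show "(\<integral>\<^sup>+g. ennreal (G g) * indicator (D (r + \<eta>)) (\<lambda>i\<in>I. X i \<omega> + \<delta> * g i) \<partial>?P) =
        (\<integral>\<^sup>+z. ennreal (\<Prod>i\<in>I. normal_density 0 \<delta> (X i \<omega> - z i)) * indicator (D (r + \<eta>)) z \<partial>?P)" by (rule sym)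
    qed
    also have "\<dots> = (\<integral>\<^sup>+z. (\<integral>\<^sup>+\<omega>. ennreal (\<Prod>i\<in>I. normal_density 0 \<delta> (X i \<omega> - z i)) * indicator (D (r + \<eta>)) z \<partial>M) \<partial>?P)"
      using I by (intro Fubini'[symmetric]) measurable
    also have "\<dots> \<le> (\<integral>\<^sup>+z. ennreal (?c * ?K) * indicator (D (r + \<eta>)) z \<partial>?P)"
    proof (intro nn_integral_mono)
      fix z
      have "integrable M (\<lambda>\<omega>. \<Prod>i\<in>I. normal_density 0 \<delta> (X i \<omega> - z i))"
      proof (rule integrable_const_bound[where B = "\<Prod>i\<in>I. 1 / sqrt (2 * pi * \<delta>\<^sup>2)"])
        show "AE \<omega> in M. norm (\<Prod>i\<in>I. normal_density 0 \<delta> (X i \<omega> - z i)) \<le> (\<Prod>i\<in>I. 1 / sqrt (2 * pi * \<delta>\<^sup>2))"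
          unfolding prod_norm[symmetric]
          by (intro AE_I2 prod_mono) (auto simp: normal_density_def intro!: divide_right_mono)
      qed (use I in measurable)
      then have "(\<integral>\<^sup>+\<omega>. ennreal (\<Prod>i\<in>I. normal_density 0 \<delta> (X i \<omega> - z i)) \<partial>M) =
          ennreal (LINT \<omega>|M. (\<Prod>i\<in>I. normal_density 0 \<delta> (X i \<omega> - z i)))"
        by (intro nn_integral_eq_integral) (auto intro!: AE_I2 prod_nonneg)
      also have "\<dots> \<le> ennreal (?c * ?K)"
        by (intro ennreal_leI smoothed_density_le I \<delta> X int)
      finally show "(\<integral>\<^sup>+\<omega>. ennreal (\<Prod>i\<in>I. normal_density 0 \<delta> (X i \<omega> - z i)) * indicator (D (r + \<eta>)) z \<partial>M) \<le>
        ennreal (?c * ?K) * indicator (D (r + \<eta>)) z"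
        by (cases "z \<in> D (r + \<eta>)") auto
    qed
    also have "\<dots> = ennreal (?c * ?K) * emeasure ?P (D (r + \<eta>))"
      by (simp add: nn_integral_cmult)
    finally show ?thesis .
  qed
  (* delta = 1 / (k + 1), so that P(|G| <= eta/delta) increases to 1 *)
  have bound: "emeasure M ?B \<le> ennreal (?c * ?K) * emeasure ?P (D (r + \<eta>))" if \<eta>: "\<eta> > 0" for \<eta>
  proof -
    have inc: "incseq (\<lambda>k. D (\<eta> * real (Suc k)))"
    proof (rule incseq_SucI)
      fix k
      have "\<eta> * real (Suc k) \<le> \<eta> * real (Suc (Suc k))" using \<eta> by simp
      then show "D (\<eta> * real (Suc k)) \<subseteq> D (\<eta> * real (Suc (Suc k)))"
        unfolding D_def by (auto intro: order_trans)
    qed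
    have "(\<lambda>k. emeasure (density ?P G) (D (\<eta> * real (Suc k)))) \<longlonglongrightarrow> emeasure (density ?P G) (\<Union>k. D (\<eta> * real (Suc k)))"
      using inc by (intro Lim_emeasure_incseq) auto
    also have "(\<Union>k. D (\<eta> * real (Suc k))) = space ?P"
    proof -
      have "\<exists>k. g \<in> D (\<eta> * real (Suc k))" if "g \<in> space ?P" for g
      proof -
        obtain k where "sqrt (\<Sum>i\<in>I. (g i)\<^sup>2) / \<eta> \<le> real k" using real_arch_simple by blast
        then have "sqrt (\<Sum>i\<in>I. (g i)\<^sup>2) \<le> \<eta> * real k" using \<eta> by (simp add: field_simps)
        also have "\<dots> \<le> \<eta> * real (Suc k)" using \<eta> by simp
        finally show ?thesis using that unfolding D_def by blast
      qed
      then show ?thesis by (auto simp: D_def)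
    qed
    also have "emeasure (density ?P G) (space ?P) = 1"
    proof -
      have "emeasure (density ?P G) (space ?P) = (\<integral>\<^sup>+g. ennreal (G g) \<partial>?P)"
        by (subst emeasure_density) (auto intro!: nn_integral_cong)
      then show ?thesis using intG by simp
    qed
    finally have lim: "(\<lambda>k. emeasure M ?B * emeasure (density ?P G) (D (\<eta> * real (Suc k)))) \<longlonglongrightarrow> emeasure M ?B * 1"
      by (intro ennreal_tendsto_cmult) (auto simp: less_top[symmetric])
    have "emeasure M ?B * emeasure (density ?P G) (D (\<eta> * real (Suc k))) \<le> ennreal (?c * ?K) * emeasure ?P (D (r + \<eta>))" for k
      using key[OF \<eta>, of "1 / real (Suc k)"] by (simp add: emeasure_density)
    then show ?thesis using LIMSEQ_le_const2[OF lim] by auto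
  qed
  have "prob ?B \<le> ?c * ?K * (unit_ball_vol (real ?n) * (r + \<eta>) ^ ?n)" if \<eta>: "\<eta> > 0" for \<eta>
  proof -
    have "ennreal (prob ?B) \<le> ennreal (?c * ?K) * ennreal (unit_ball_vol (real ?n) * (r + \<eta>) ^ ?n)"
      using bound[OF \<eta>] volD[of "r + \<eta>"] \<eta> r by (simp add: emeasure_eq_measure)
    also have "\<dots> = ennreal (?c * ?K * (unit_ball_vol (real ?n) * (r + \<eta>) ^ ?n))"
      using K0 by (subst ennreal_mult') auto
    finally show ?thesis using K0 \<eta> r by (subst (asm) ennreal_le_iff) auto
  qed
  moreover have "((\<lambda>\<eta>. ?c * ?K * (unit_ball_vol (real ?n) * (r + \<eta>) ^ ?n)) \<longlongrightarrow>
      ?c * ?K * (unit_ball_vol (real ?n) * (r + 0) ^ ?n)) (at_right 0)"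
    by (intro tendsto_intros)
  ultimately have "prob ?B \<le> ?c * ?K * (unit_ball_vol (real ?n) * (r + 0) ^ ?n)"
    by (intro tendsto_lowerbound[where F = "at_right (0::real)"])
       (auto simp: eventually_at_filter)
  then show ?thesis by (simp add: mult_ac)
qed

section \<open>The stable measure of a ball\<close>

lemma ennreal_exp_minus_eq_tail:
  fixes s :: real
  shows "ennreal (exp (- s)) = (\<integral>\<^sup>+t. ennreal (exp (- t)) * indicator {s..} t \<partial>lborel)"
proof -
  have "((\<lambda>t::real. - exp (- t)) \<longlongrightarrow> - 0) at_top"
    by (intro tendsto_minus filterlim_compose[OF exp_at_bot] filterlim_uminus_at_bot_at_top)
  then have "(\<integral>\<^sup>+t. ennreal (exp (- t)) * indicator {s..} t \<partial>lborel) = ennreal (0 - (- exp (- s)))"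
    by (intro nn_integral_FTC_atLeast) (auto intro!: derivative_eq_intros)
  then show ?thesis by simp
qed

text \<open>
  The integrand depends on \<open>y\<close> only through a quadratic form, so it is integrated over its
  level sets. Writing \<open>exp (- s)\<close> as the integral of \<open>exp (- t)\<close> over \<open>t \<ge> s\<close> and exchanging
  the integrals leaves the volume of an ellipsoid of radius \<open>(2 t) powr (1 / \<alpha>)\<close>, and the
  remaining integral over \<open>t\<close> is a Gamma integral.
\<close>
lemma nn_integral_exp_minus_quadratic_powr:
  fixes a :: "'i \<Rightarrow> real" and \<alpha> :: real
  assumes I: "finite I" and a: "\<And>i. i \<in> I \<Longrightarrow> 0 < a i" and \<alpha>: "0 < \<alpha>"
  shows "(\<integral>\<^sup>+y. ennreal (exp (- (1 / 2) * (\<Sum>i\<in>I. a i * (y i)\<^sup>2) powr (\<alpha> / 2))) \<partial>Pi\<^sub>M I (\<lambda>_. lborel)) =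
    ennreal (unit_ball_vol (real (card I)) * 2 powr (card I / \<alpha>) * Gamma (card I / \<alpha> + 1) / (\<Prod>i\<in>I. sqrt (a i)))"
proof -
  let ?P = "Pi\<^sub>M I (\<lambda>_. lborel :: real measure)"
  let ?n = "real (card I)"
  interpret PI: finite_product_sigma_finite "\<lambda>_. lborel :: real measure" I by standard fact
  interpret pair_sigma_finite ?P "lborel :: real measure" by standard
  define q where "q = (\<lambda>y. \<Sum>i\<in>I. a i * (y i)\<^sup>2)"
  define w where "w = unit_ball_vol ?n / (\<Prod>i\<in>I. sqrt (a i))"
  have w: "0 \<le> w" unfolding w_def using a by (intro divide_nonneg_nonneg prod_nonneg) (auto simp: less_imp_le)
  have [measurable]: "q \<in> borel_measurable ?P" unfolding q_def using I by measurable
  have q0: "0 \<le> q y" for y unfolding q_def using a by (intro sum_nonneg) (auto simp: less_imp_le)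
  have vol: "emeasure ?P {y \<in> space ?P. (1 / 2) * q y powr (\<alpha> / 2) \<le> t} = ennreal (w * (2 * t) powr (?n / \<alpha>))" if t: "t > 0" for t
  proof -
    have "(1 / 2) * q y powr (\<alpha> / 2) \<le> t \<longleftrightarrow> sqrt (q y) \<le> (2 * t) powr (1 / \<alpha>)" for y
    proof -
      have "(1 / 2) * q y powr (\<alpha> / 2) \<le> t \<longleftrightarrow> sqrt (q y) powr \<alpha> \<le> ((2 * t) powr (1 / \<alpha>)) powr \<alpha>"
        using \<alpha> t q0[of y] by (auto simp: powr_powr powr_half_sqrt[symmetric])
      also have "\<dots> \<longleftrightarrow> sqrt (q y) \<le> (2 * t) powr (1 / \<alpha>)"
        using \<alpha> q0[of y] powr_mono2[of \<alpha> "sqrt (q y)" "(2 * t) powr (1 / \<alpha>)"]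
          powr_less_mono2[of \<alpha> "(2 * t) powr (1 / \<alpha>)" "sqrt (q y)"] by (force simp: not_le[symmetric])
      finally show ?thesis .
    qed
    then have "emeasure ?P {y \<in> space ?P. (1 / 2) * q y powr (\<alpha> / 2) \<le> t} = 
        ennreal (unit_ball_vol ?n * ((2 * t) powr (1 / \<alpha>)) ^ card I / (\<Prod>i\<in>I. sqrt (a i)))"
      unfolding q_def using emeasure_PiM_lborel_ellipsoid[of I a, OF I a, where r = "(2 * t) powr (1 / \<alpha>)"] t by simp
    also have "((2 * t) powr (1 / \<alpha>)) ^ card I = (2 * t) powr (?n / \<alpha>)"
      using t by (subst powr_realpow[symmetric]) (auto simp: powr_powr)
    finally show ?thesis by (simp add: w_def)
  qed
  have "(\<integral>\<^sup>+y. ennreal (exp (- (1 / 2) * q y powr (\<alpha> / 2))) \<partial>?P) =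
      (\<integral>\<^sup>+y. (\<integral>\<^sup>+t. ennreal (exp (- t)) * indicator {(1 / 2) * q y powr (\<alpha> / 2)..} t \<partial>lborel) \<partial>?P)"
    using ennreal_exp_minus_eq_tail[of "(1 / 2) * q y powr (\<alpha> / 2)" for y] by simp
  also have "\<dots> = (\<integral>\<^sup>+t. (\<integral>\<^sup>+y. ennreal (exp (- t)) * indicator {(1 / 2) * q y powr (\<alpha> / 2)..} t \<partial>?P) \<partial>lborel)"
    by (intro Fubini'[symmetric]) (auto simp: indicator_def)
  also have "\<dots> = (\<integral>\<^sup>+t. ennreal (w * 2 powr (?n / \<alpha>)) * ennreal (indicator {0..} t * t powr (?n / \<alpha> + 1 - 1) / exp t) \<partial>lborel)"
  proof (rule nn_integral_cong_AE)
    (* t = 0 is discarded because the level set is then an ellipsoid of radius 0 *)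
    have "AE t in lborel. t \<noteq> (0::real)" by (rule AE_lborel_singleton)
    then show "AE t in lborel. (\<integral>\<^sup>+y. ennreal (exp (- t)) * indicator {(1 / 2) * q y powr (\<alpha> / 2)..} t \<partial>?P) =
        ennreal (w * 2 powr (?n / \<alpha>)) * ennreal (indicator {0..} t * t powr (?n / \<alpha> + 1 - 1) / exp t)"
    proof eventually_elim
      fix t :: real assume t: "t \<noteq> 0"
      have "(\<integral>\<^sup>+y. ennreal (exp (- t)) * indicator {(1 / 2) * q y powr (\<alpha> / 2)..} t \<partial>?P) =
          (\<integral>\<^sup>+y. ennreal (exp (- t)) * indicator {y \<in> space ?P. (1 / 2) * q y powr (\<alpha> / 2) \<le> t} y \<partial>?P)"
        by (rule nn_integral_cong) (auto simp: indicator_def)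
      also have "\<dots> = ennreal (exp (- t)) * emeasure ?P {y \<in> space ?P. (1 / 2) * q y powr (\<alpha> / 2) \<le> t}"
        by (rule nn_integral_cmult_indicator) measurable
      also have "\<dots> = ennreal (w * 2 powr (?n / \<alpha>)) * ennreal (indicator {0..} t * t powr (?n / \<alpha> + 1 - 1) / exp t)"
      proof (cases "t > 0")
        case True
        have "ennreal (exp (- t)) * ennreal (w * (2 * t) powr (?n / \<alpha>)) = 
          ennreal (w * 2 powr (?n / \<alpha>)) * ennreal (t powr (?n / \<alpha> + 1 - 1) / exp t)"
          using True w by (simp add: ennreal_mult'[symmetric] powr_mult exp_minus field_simps)
        then show ?thesis using True vol[OF True] by simp
      next
        case False
        have "\<not> (1 / 2) * q y powr (\<alpha> / 2) \<le> t" for y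
        proof -
          have "0 \<le> (1 / 2) * q y powr (\<alpha> / 2)" by simp
          then show ?thesis using False t by linarith
        qed
        then have empty: "{y \<in> space ?P. (1 / 2) * q y powr (\<alpha> / 2) \<le> t} = {}" by blast
        show ?thesis unfolding empty using False t by simp
      qed
      finally show "(\<integral>\<^sup>+y. ennreal (exp (- t)) * indicator {(1 / 2) * q y powr (\<alpha> / 2)..} t \<partial>?P) =
        ennreal (w * 2 powr (?n / \<alpha>)) * ennreal (indicator {0..} t * t powr (?n / \<alpha> + 1 - 1) / exp t)" .
    qed
  qed
  also have "\<dots> = ennreal (w * 2 powr (?n / \<alpha>)) * (\<integral>\<^sup>+t. ennreal (indicator {0..} t * t powr (?n / \<alpha> + 1 - 1) / exp t) \<partial>lborel)"
    by (rule nn_integral_cmult) measurable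
  also have "(\<integral>\<^sup>+t. ennreal (indicator {0..} t * t powr (?n / \<alpha> + 1 - 1) / exp t) \<partial>lborel) = ennreal (Gamma (?n / \<alpha> + 1))"
    using \<alpha> by (intro Gamma_conv_nn_integral_real[symmetric] add_nonneg_pos) auto
  also have "ennreal (w * 2 powr (?n / \<alpha>)) * ennreal (Gamma (?n / \<alpha> + 1)) = ennreal (w * 2 powr (?n / \<alpha>) * Gamma (?n / \<alpha> + 1))"
    using w by (intro ennreal_mult'[symmetric]) auto
  finally show ?thesis by (simp add: q_def w_def)
qed

text \<open>The map \<open>truncated n\<close> embeds the first \<open>n\<close> coordinates into the sequence space; pairing with
  its values extracts the joint law of the first \<open>n\<close> coordinates from \<open>charf\<close>.\<close>

definition truncated :: "nat \<Rightarrow> (nat \<Rightarrow> real) \<Rightarrow> ell2" where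
  "truncated n y = Abs_ell2 (\<lambda>i. if i < n then y i else 0)"

lemma coord_truncated: "coord (truncated n y) i = (if i < n then y i else 0)"
proof -
  have "summable (\<lambda>i. (if i < n then y i else 0)\<^sup>2)"
    by (rule summable_finite[of "{..<n}"]) auto
  then show ?thesis by (simp add: truncated_def Abs_ell2_inverse)
qed

lemma inner_truncated: "x \<bullet> truncated n y = (\<Sum>i<n. coord x i * y i)"
  unfolding inner_ell2_def
  by (subst suminf_finite[of "{..<n}"]) (auto simp: coord_truncated)

lemma borel_measurable_coord: "(\<lambda>x. coord x i) \<in> borel_measurable borel"
proof -
  have "coord x i = x \<bullet> truncated (Suc i) (\<lambda>j. if j = i then 1 else 0)" for x
    by (simp add: inner_truncated if_distrib cong: if_cong)
  then show ?thesis by (simp add: borel_measurable_continuous_onI continuous_intros)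
qed

lemma sum_coord_square_le_norm: "sqrt (\<Sum>i<n. (coord x i)\<^sup>2) \<le> norm x"
proof -
  have "(\<Sum>i<n. (coord x i)\<^sup>2) \<le> (\<Sum>i. (coord x i)\<^sup>2)"
    by (intro sum_le_suminf summable_coord_sq) auto
  then show ?thesis by (simp add: norm_ell2_def inner_ell2_def power2_eq_square)
qed

text \<open>
  A ball of the sequence space is contained in the cylinder over the ball of the same radius in
  the first \<open>n\<close> coordinates, and the characteristic function of those coordinates is explicit.
  The square of \<open>unit_ball_vol n\<close> arises because the volume of balls enters twice: once for
  the set whose probability is estimated and once through the integral of the characteristic
  function over its level sets.
\<close>
lemma stable_ball_le:
  fixes lam :: "nat \<Rightarrow> real" and \<nu> :: "ell2 measure" and \<alpha> \<epsilon> :: real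
  assumes \<alpha>: "0 < \<alpha>" and \<epsilon>: "0 < \<epsilon>" and lam: "\<And>i. 0 < lam i"
    and \<nu>: "prob_space \<nu>" "sets \<nu> = sets borel"
    and char: "\<And>y. charf \<nu> y =
        complex_of_real (exp (- (1 / 2) * (\<Sum>i. lam i * (coord y i)\<^sup>2) powr (\<alpha> / 2)))"
  shows "measure \<nu> (cball 0 \<epsilon>) \<le> \<epsilon> ^ n * (unit_ball_vol n)\<^sup>2 * (1 / (2 * pi)) ^ n *
    2 powr (n / \<alpha>) * Gamma (n / \<alpha> + 1) / (\<Prod>i<n. sqrt (lam i))"
proof -
  let ?P = "Pi\<^sub>M {..<n} (\<lambda>_. lborel :: real measure)"
  define J where "J = unit_ball_vol n * 2 powr (n / \<alpha>) * Gamma (n / \<alpha> + 1) / (\<Prod>i<n. sqrt (lam i))"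
  define e where "e = (\<lambda>y. exp (- (1 / 2) * (\<Sum>i<n. lam i * (y i)\<^sup>2) powr (\<alpha> / 2)))"
  interpret prob_space \<nu> by fact
  have meas: "(\<lambda>x. coord x i) \<in> borel_measurable \<nu>" for i
    using borel_measurable_coord measurable_cong_sets[OF \<nu>(2) refl] by blast
  have chf: "(CLINT x|\<nu>. iexp (\<Sum>i<n. coord x i * y i)) = complex_of_real (e y)" for y
  proof -
    have "(\<Sum>i. lam i * (coord (truncated n y) i)\<^sup>2) = (\<Sum>i<n. lam i * (y i)\<^sup>2)"
      by (subst suminf_finite[of "{..<n}"]) (auto simp: coord_truncated)
    then show ?thesis
      using char[of "truncated n y"] unfolding charf_def inner_truncated e_def by simp
  qed
  have nn: "(\<integral>\<^sup>+y. ennreal (e y) \<partial>?P) = ennreal J"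
    using nn_integral_exp_minus_quadratic_powr[of "{..<n}" lam \<alpha>] lam \<alpha> by (simp add: e_def J_def)
  have [measurable]: "e \<in> borel_measurable ?P" unfolding e_def by measurable
  have int: "integrable ?P e"
    using nn by (intro integrableI_nonneg) (auto simp: e_def)
  have J0: "0 \<le> J" unfolding J_def using \<alpha> lam
    by (intro mult_nonneg_nonneg divide_nonneg_nonneg prod_nonneg)
       (auto simp: less_imp_le intro!: less_imp_le[OF Gamma_real_pos] add_nonneg_pos)
  have lint: "(LINT y|?P. e y) = J"
    using nn J0 by (intro integral_eq_nn_integral[THEN trans]) (auto simp: e_def)
  have "measure \<nu> (cball 0 \<epsilon>) \<le> prob {x \<in> space \<nu>. sqrt (\<Sum>i<n. (coord x i)\<^sup>2) \<le> \<epsilon>}"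
  proof (rule finite_measure_mono)
    show "cball 0 \<epsilon> \<subseteq> {x \<in> space \<nu>. sqrt (\<Sum>i<n. (coord x i)\<^sup>2) \<le> \<epsilon>}"
      using sets_eq_imp_space_eq[OF \<nu>(2)]
      by (auto intro: order_trans[OF sum_coord_square_le_norm])
    show "{x \<in> space \<nu>. sqrt (\<Sum>i<n. (coord x i)\<^sup>2) \<le> \<epsilon>} \<in> events"
      using meas by measurable
  qed
  also have "\<dots> \<le> unit_ball_vol n * \<epsilon> ^ n * (1 / (2 * pi)) ^ n * J"
  proof -
    have nchf: "norm (CLINT x|\<nu>. iexp (\<Sum>i<n. coord x i * y i)) = e y" for y
      unfolding chf by (simp add: e_def)
    show ?thesis
      using prob_ball_le_integral_char[of "{..<n}" \<epsilon> "\<lambda>i x. coord x i", unfolded nchf lint] meas \<epsilon> int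
      by simp
  qed
  finally show ?thesis by (simp add: J_def power2_eq_square mult_ac)
qed

section \<open>Stirling's approximation\<close>

text \<open>Stirling's approximation of \<open>ln (Gamma (x + 1))\<close>, up to a bounded error.\<close>

definition stirling :: "real \<Rightarrow> real" where
  "stirling x = (x + 1 / 2) * ln x - x"

text \<open>
  Along the sequence \<open>x\<close>, \<open>x + 1\<close>, \<open>\<dots>\<close> the error of Stirling's approximation decreases, and by at most
  a telescoping amount. Since \<open>Gamma (x + 2) = (x + 1) Gamma (x + 1)\<close>, both inequalities are
  bounds for \<open>ln (x + 1) - ln x\<close>: the midpoint and the trapezoidal rule for \<open>1 / x\<close>.
\<close>
lemma ln_Gamma_stirling_step:
  assumes x: "(x::real) > 0"
  defines "g \<equiv> \<lambda>x. ln (Gamma (x + 1)) - stirling x"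
  shows "g (x + 1) \<le> g x" "g x \<le> g (x + 1) + (1 / x - 1 / (x + 1)) / 4"
proof -
  have "x + 1 \<notin> \<int>\<^sub>\<le>\<^sub>0" using x by (auto elim!: nonpos_Ints_cases)
  moreover have "0 < Gamma (x + 1)" using x by (intro Gamma_real_pos) auto
  ultimately have "ln (Gamma (x + 1 + 1)) = ln (x + 1) + ln (Gamma (x + 1))"
    using x by (subst Gamma_plus1) (auto intro!: ln_mult_pos)
  then have diff: "g (x + 1) - g x = 1 - (x + 1 / 2) * (ln (x + 1) - ln x)"
    unfolding g_def stirling_def by (simp add: algebra_simps)
  have "(x + 1 / 2) * (2 / (2 * x + 1)) \<le> (x + 1 / 2) * (ln (x + 1) - ln x)"
    using ln_inverse_approx_ge[of x "x + 1"] x by (intro mult_left_mono) auto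
  moreover have "(x + 1 / 2) * (2 / (2 * x + 1)) = 1" using x by (simp add: field_simps)
  ultimately show "g (x + 1) \<le> g x" using diff by linarith
  have "(x + 1 / 2) * (ln (x + 1) - ln x) \<le> (x + 1 / 2) * ((inverse x + inverse (x + 1)) / 2)"
    using ln_inverse_approx_le[of x 1] x by (intro mult_left_mono) auto
  moreover have "(x + 1 / 2) * ((inverse x + inverse (x + 1)) / 2) = 1 + (1 / x - 1 / (x + 1)) / 4"
  proof -
    have "x + 1 \<noteq> 0" "x \<noteq> 0" using x by auto
    then show ?thesis by (simp add: divide_simps) (simp add: algebra_simps)
  qed
  ultimately show "g x \<le> g (x + 1) + (1 / x - 1 / (x + 1)) / 4" using diff by linarith
qed

text \<open>
  Every \<open>x \<ge> 1 / 2\<close> is a point of the compact interval \<open>{1 / 2..3 / 2}\<close>, on which the error is bounded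
  by continuity, shifted by a natural number, and shifting changes the error boundedly. The
  range starts at \<open>1 / 2\<close> because the bound is applied to \<open>n / 2\<close> and to \<open>n / \<alpha>\<close> with \<open>\<alpha> \<le> 2\<close>.
\<close>
lemma ln_Gamma_stirling_bound:
  "\<exists>B. \<forall>x\<ge>1 / 2. \<bar>ln (Gamma (x + 1)) - stirling x\<bar> \<le> B"
proof -
  define g where "g = (\<lambda>x. ln (Gamma (x + 1)) - stirling x)"
  have "continuous_on {1 / 2..3 / 2 :: real} g"
    unfolding g_def stirling_def
    by (intro continuous_intros continuous_on_compose2[OF continuous_on_Gamma[of "{0<..}"]])
       (auto simp: nonpos_Ints_def Gamma_eq_zero_iff)
  then have "bounded (g ` {1 / 2..3 / 2})"
    by (intro compact_imp_bounded compact_continuous_image) auto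
  then obtain B where "\<forall>v\<in>g ` {1 / 2..3 / 2}. norm v \<le> B"
    unfolding bounded_iff by blast
  then have B: "\<bar>g x\<bar> \<le> B" if "x \<in> {1 / 2..3 / 2}" for x
    using that by auto
  have shift: "g (y + real k) \<le> g y \<and> g y \<le> g (y + real k) + (1 / y - 1 / (y + real k)) / 4" if y: "y > 0" for y k
  proof (induction k)
    case (Suc k)
    have "g (y + real k + 1) \<le> g (y + real k)"
         "g (y + real k) \<le> g (y + real k + 1) + (1 / (y + real k) - 1 / (y + real k + 1)) / 4"
      unfolding g_def using ln_Gamma_stirling_step[of "y + real k"] y by auto
    moreover have "y + real (Suc k) = y + real k + 1" by simp
    ultimately show ?case using Suc.IH by (simp only:) argo
  qed simp
  have "\<bar>g x\<bar> \<le> B + 1" if x: "x \<ge> 1 / 2" for x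
  proof -
    define k where "k = nat \<lfloor>x - 1 / 2\<rfloor>"
    define y where "y = x - real k"
    have "real k \<le> x - 1 / 2" "x - 1 / 2 < real k + 1"
      using x unfolding k_def by linarith+
    then have y: "y \<in> {1 / 2..3 / 2}" unfolding y_def by auto
    have "1 / y \<le> 2" using y by (simp add: field_simps)
    moreover have "0 \<le> 1 / x" using x by auto
    ultimately have "1 / y - 1 / x \<le> 2" by linarith
    then have "(1 / y - 1 / x) / 4 \<le> 2 / 4" by (rule divide_right_mono) simp
    then have "(1 / y - 1 / x) / 4 \<le> 1" by (rule order_trans) simp
    moreover have "g x \<le> g y" "g y \<le> g x + (1 / y - 1 / x) / 4"
      using shift[of y k] y by (auto simp: y_def)
    ultimately have "g x \<le> g y" "g y \<le> g x + 1"
      by (blast, meson add_left_mono order_trans)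
    then show ?thesis using B[OF y] by (simp add: abs_le_iff)
  qed
  then show ?thesis unfolding g_def by blast
qed

text \<open>
  The factors of the ball estimate that depend only on \<open>n\<close> and \<open>\<alpha>\<close>, compared with those in
  the product of \<open>kappa \<alpha> \<sigma> j\<close> over \<open>j = 1, \<dots>, n\<close>. Under Stirling's approximation all terms of
  order \<open>n * ln n\<close> and \<open>n\<close> cancel, and those of order \<open>ln n\<close> leave \<open>- ln n / (2 * \<alpha>)\<close>.
\<close>
lemma ball_gamma_factor_bound:
  fixes \<alpha> :: real
  assumes \<alpha>: "0 < \<alpha>" "\<alpha> \<le> 2"
  shows "\<exists>C. \<forall>n\<ge>1. 2 * ln (unit_ball_vol (real n)) - n * ln (2 * pi) + n / \<alpha> * ln 2 + ln (Gamma (n / \<alpha> + 1)) \<le>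
     n / \<alpha> * ln (2 / \<alpha>) + (1 - \<alpha>) / \<alpha> * ln (fact n) - ln n / (2 * \<alpha>) + C"
proof -
  obtain B where B: "\<And>x. x \<ge> 1 / 2 \<Longrightarrow> \<bar>ln (Gamma (x + 1)) - stirling x\<bar> \<le> B"
    using ln_Gamma_stirling_bound by blast
  define c where "c = (1 - \<alpha>) / \<alpha>"
  define C where "C = 3 * B + \<bar>c\<bar> * B + ln 2 - ln \<alpha> / 2"
  have "2 * ln (unit_ball_vol (real n)) - n * ln (2 * pi) + n / \<alpha> * ln 2 + ln (Gamma (n / \<alpha> + 1)) \<le>
     n / \<alpha> * ln (2 / \<alpha>) + c * ln (fact n) - ln n / (2 * \<alpha>) + C" if n: "n \<ge> 1" for n :: nat
  proof -
    have "ln (unit_ball_vol (real n)) = n / 2 * ln pi - ln (Gamma (n / 2 + 1))"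
    proof -
      have "0 < Gamma (n / 2 + 1)" by (intro Gamma_real_pos) auto
      then show ?thesis unfolding unit_ball_vol_def by (subst ln_divide_pos) (auto simp: ln_powr)
    qed
    moreover have "- ln (Gamma (n / 2 + 1)) \<le> - stirling (n / 2) + B"
      using B[of "n / 2"] n by (simp add: abs_le_iff)
    moreover have "ln (Gamma (n / \<alpha> + 1)) \<le> stirling (n / \<alpha>) + B"
    proof -
      have "1 / 2 \<le> 1 / \<alpha>" using \<alpha> by (simp add: field_simps)
      also have "\<dots> \<le> n / \<alpha>" using n \<alpha> by (intro divide_right_mono) auto
      finally show ?thesis using B[of "n / \<alpha>"] by (simp add: abs_le_iff)
    qed
    moreover have "c * stirling n \<le> c * ln (fact n) + \<bar>c\<bar> * B"
    proof -
      have "\<bar>ln (fact n) - stirling n\<bar> \<le> B"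
        using B[of "real n"] n by (simp add: Gamma_fact add.commute)
      then have "\<bar>c\<bar> * \<bar>ln (fact n) - stirling n\<bar> \<le> \<bar>c\<bar> * B" by (intro mult_left_mono) auto
      then have "\<bar>c * (ln (fact n) - stirling n)\<bar> \<le> \<bar>c\<bar> * B" by (simp add: abs_mult)
      then show ?thesis by (simp add: abs_le_iff algebra_simps)
    qed
    moreover have "n * ln pi - n * ln (2 * pi) + n / \<alpha> * ln 2 - 2 * stirling (n / 2) + stirling (n / \<alpha>)
      = n / \<alpha> * ln (2 / \<alpha>) + c * stirling n - ln n / (2 * \<alpha>) + ln 2 - ln \<alpha> / 2"
      unfolding stirling_def c_def using n \<alpha> by (simp add: ln_div ln_mult) (simp add: field_simps)
    ultimately show ?thesis unfolding C_def by simp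
  qed
  then show ?thesis unfolding c_def by blast
qed

section \<open>Sums and integrals\<close>

lemma sum_le_integral_of_mono:
  fixes f :: "real \<Rightarrow> real"
  assumes f: "mono_on {1..} f" "continuous_on {1..} f" and n: "1 \<le> n"
  shows "(\<Sum>j\<in>{1..<n}. f (real j)) \<le> integral {1..real n} f"
  using n
proof (induction n rule: nat_induct_at_least)
  case (Suc n)
  have int: "f integrable_on {a..b}" if "1 \<le> a" for a b
    using that by (intro integrable_continuous_interval continuous_on_subset[OF f(2)]) auto
  have "f n = integral {real n..real (Suc n)} (\<lambda>_. f n)" by simp
  also have "\<dots> \<le> integral {real n..real (Suc n)} f"
    using Suc.hyps by (intro integral_le int) (auto intro!: monotone_onD[OF f(1)])
  finally have "f n \<le> integral {real n..real (Suc n)} f" .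
  moreover have "integral {1..real n} f + integral {real n..real (Suc n)} f = integral {1..real (Suc n)} f"
    using Suc.hyps by (intro Henstock_Kurzweil_Integration.integral_combine int) auto
  ultimately show ?case using Suc.IH Suc.hyps by simp
qed simp

lemma integral_le_trapezoid_of_convex:
  fixes f :: "real \<Rightarrow> real"
  assumes f: "convex_on {1..} f" "continuous_on {1..} f" and n: "1 \<le> n"
  shows "integral {1..real n} f \<le> (\<Sum>j\<in>{1..n}. f (real j)) - (f 1 + f (real n)) / 2"
  using n
proof (induction n rule: nat_induct_at_least)
  case (Suc n)
  have int: "f integrable_on {a..b}" if "1 \<le> a" for a b
    using that by (intro integrable_continuous_interval continuous_on_subset[OF f(2)]) auto
  let ?m = "f (real (Suc n)) - f (real n)"
  have "((\<lambda>x. f (real n) + (x - real n) * ?m) has_integral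
      ((f (real n) * real (Suc n) + (real (Suc n) - real n)\<^sup>2 / 2 * ?m) - (f (real n) * real n + (real n - real n)\<^sup>2 / 2 * ?m)))
      {real n..real (Suc n)}"
    by (rule fundamental_theorem_of_calculus)
       (auto intro!: derivative_eq_intros simp: has_real_derivative_iff_has_vector_derivative[symmetric])
  then have lin: "((\<lambda>x. f (real n) + (x - real n) * ?m) has_integral ((f (real n) + f (real (Suc n))) / 2)) {real n..real (Suc n)}"
    by (simp add: algebra_simps add_divide_distrib)
  have "integral {real n..real (Suc n)} f \<le> (f (real n) + f (real (Suc n))) / 2"
  proof (rule has_integral_le[OF integrable_integral[OF int] lin])
    fix x assume x: "x \<in> {real n..real (Suc n)}"
    have "f ((1 - (x - real n)) *\<^sub>R real n + (x - real n) *\<^sub>R real (Suc n)) \<le>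
       (1 - (x - real n)) * f (real n) + (x - real n) * f (real (Suc n))"
      using x Suc.hyps by (intro convex_onD[OF f(1)]) auto
    then show "f x \<le> f (real n) + (x - real n) * ?m" by (simp add: algebra_simps)
  qed (use Suc.hyps in auto)
  moreover have "integral {1..real n} f + integral {real n..real (Suc n)} f = integral {1..real (Suc n)} f"
    using Suc.hyps by (intro Henstock_Kurzweil_Integration.integral_combine int) auto
  ultimately show ?case using Suc.IH Suc.hyps by (simp add: field_simps)
qed simp

section \<open>The exponent of the bound\<close>

context
  fixes \<alpha> :: real and \<sigma> :: "real \<Rightarrow> real"
  assumes \<alpha>: "0 < \<alpha>" and \<sigma>: "\<And>x. 1 \<le> x \<Longrightarrow> 0 < \<sigma> x" "\<sigma> differentiable_on {1..}"
begin

lemma continuous_on_ln_sigma: "continuous_on {1..} (\<lambda>x. ln (\<sigma> x))"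
  using \<sigma>(1) by (intro continuous_intros differentiable_imp_continuous_on[OF \<sigma>(2)]) (auto simp: less_le)

lemma kappa_pos: "1 \<le> x \<Longrightarrow> 0 < kappa \<alpha> \<sigma> x"
  using \<alpha> \<sigma>(1) by (simp add: kappa_def)

lemma ln_kappa:
  "1 \<le> x \<Longrightarrow> ln (kappa \<alpha> \<sigma> x) = ln (2 / \<alpha>) / \<alpha> + (1 - \<alpha>) / \<alpha> * ln x - ln (\<sigma> x)"
  using \<alpha> \<sigma>(1)[of x] by (simp add: kappa_def ln_mult ln_powr ln_inverse)

text \<open>
  Integration by parts: \<open>x \<kappa>'(x) / \<kappa>(x)\<close> is the derivative of
  \<open>x * ln \<kappa>(x) - \<integral>\<^sub>1\<^sup>x ln \<kappa>\<close>. Since \<open>L\<close> is a gauge integral, the fundamental theorem of calculus applies to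
  every differentiable \<open>\<sigma>\<close>, however irregular its derivative.
\<close>
lemma L_eq:
  assumes y: "1 \<le> y"
  shows "L \<alpha> \<sigma> y = y * ln (kappa \<alpha> \<sigma> y) - ln (kappa \<alpha> \<sigma> 1) - integral {1..y} (\<lambda>x. ln (kappa \<alpha> \<sigma> x))"
proof -
  let ?k = "kappa \<alpha> \<sigma>"
  let ?k' = "\<lambda>x. vector_derivative ?k (at x within {1..})"
  define F where "F x = x * ln (?k x) - integral {1..x} (\<lambda>x. ln (?k x))" for x
  have cont: "continuous_on {1..} (\<lambda>x. ln (?k x))"
  proof -
    have "continuous_on {1..} (\<lambda>x. ln (2 / \<alpha>) / \<alpha> + (1 - \<alpha>) / \<alpha> * ln x - ln (\<sigma> x))"
      by (intro continuous_intros continuous_on_ln_sigma) auto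
    then show ?thesis by (rule continuous_on_eq) (simp add: ln_kappa)
  qed
  have der: "(?k has_real_derivative ?k' x) (at x within {1..})" if x: "1 \<le> x" for x
  proof -
    have "\<sigma> differentiable (at x within {1..})" using \<sigma>(2) x by (simp add: differentiable_on_def)
    then obtain D where D: "(\<sigma> has_real_derivative D) (at x within {1..})"
      using real_differentiableE by blast
    have "\<exists>D'. (?k has_real_derivative D') (at x within {1..})"
      unfolding kappa_def[abs_def] using x \<sigma>(1)[OF x]
      by (intro exI) (rule derivative_eq_intros D refl | simp)+
    then have "?k differentiable (at x within {1..})"
      by (auto simp: real_differentiable_def)
    then show ?thesis
      by (simp add: vector_derivative_works has_real_derivative_iff_has_vector_derivative)
  qed
  have "((\<lambda>x. x * ?k' x / ?k x) has_integral (F y - F 1)) {1..y}"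
  proof (rule fundamental_theorem_of_calculus[OF y])
    fix x assume x: "x \<in> {1..y}"
    have "(?k has_real_derivative ?k' x) (at x within {1..y})"
      using der[of x] x by (auto intro: has_field_derivative_subset)
    moreover have "((\<lambda>x. integral {1..x} (\<lambda>x. ln (?k x))) has_real_derivative ln (?k x)) (at x within {1..y})"
      unfolding has_real_derivative_iff_has_vector_derivative
      using x by (intro integral_has_vector_derivative continuous_on_subset[OF cont]) auto
    ultimately have "(F has_real_derivative x * ?k' x / ?k x) (at x within {1..y})"
      unfolding F_def[abs_def] using kappa_pos[of x] x
      by (auto intro!: derivative_eq_intros simp: field_simps)
    then show "(F has_vector_derivative x * ?k' x / ?k x) (at x within {1..y})"
      by (simp add: has_real_derivative_iff_has_vector_derivative)
  qed
  then have "L \<alpha> \<sigma> y = F y - F 1" unfolding L_def by (rule integral_unique)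
  then show ?thesis by (simp add: F_def)
qed

lemma integral_ln_kappa:
  assumes y: "1 \<le> y"
  shows "integral {1..y} (\<lambda>x. ln (kappa \<alpha> \<sigma> x)) =
    (y - 1) * (ln (2 / \<alpha>) / \<alpha>) + (1 - \<alpha>) / \<alpha> * (y * ln y - y + 1) - integral {1..y} (\<lambda>x. ln (\<sigma> x))"
proof -
  have "((\<lambda>x. ln x) has_integral ((y * ln y - y) - (1 * ln 1 - 1))) {1..y}"
    using y by (intro fundamental_theorem_of_calculus)
      (auto intro!: derivative_eq_intros simp: has_real_derivative_iff_has_vector_derivative[symmetric])
  moreover have "((\<lambda>x. ln (\<sigma> x)) has_integral integral {1..y} (\<lambda>x. ln (\<sigma> x))) {1..y}"
    by (intro integrable_integral integrable_continuous_interval continuous_on_subset[OF continuous_on_ln_sigma]) auto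
  moreover have "((\<lambda>x. ln (2 / \<alpha>) / \<alpha>) has_integral ((y - 1) * (ln (2 / \<alpha>) / \<alpha>))) {1..y}"
    using has_integral_const_real[of "ln (2 / \<alpha>) / \<alpha>" 1 y] y by simp
  ultimately have "((\<lambda>x. ln (2 / \<alpha>) / \<alpha> + (1 - \<alpha>) / \<alpha> * ln x - ln (\<sigma> x)) has_integral
    ((y - 1) * (ln (2 / \<alpha>) / \<alpha>) + (1 - \<alpha>) / \<alpha> * ((y * ln y - y) - (1 * ln 1 - 1)) - integral {1..y} (\<lambda>x. ln (\<sigma> x)))) {1..y}"
    by (intro has_integral_add has_integral_diff has_integral_mult_right)
  then have "((\<lambda>x. ln (kappa \<alpha> \<sigma> x)) has_integral
    ((y - 1) * (ln (2 / \<alpha>) / \<alpha>) + (1 - \<alpha>) / \<alpha> * ((y * ln y - y) - (1 * ln 1 - 1)) - integral {1..y} (\<lambda>x. ln (\<sigma> x)))) {1..y}"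
    by (rule has_integral_eq[rotated]) (simp add: ln_kappa)
  then show ?thesis by (simp add: integral_unique)
qed

text \<open>
  The exponent of the ball estimate plus \<open>L \<alpha> \<sigma> n\<close>. Both expand into terms in \<open>ln\<close>, \<open>ln (fact n)\<close> and
  \<open>\<sigma>\<close>; Stirling's approximation removes the factorial, and the difference of the sum and the
  integral of \<open>ln \<circ> \<sigma>\<close> is all that remains of \<open>\<sigma>\<close> apart from its values at \<open>1\<close> and \<open>n\<close>.
\<close>
lemma ball_exponent_add_L_le:
  fixes \<epsilon> B :: real and n :: nat
  defines "c \<equiv> (1 - \<alpha>) / \<alpha>"
  assumes n: "1 \<le> n" and B: "\<bar>ln (fact n) - stirling n\<bar> \<le> B"
  shows "n * ln \<epsilon> + n * (ln (2 / \<alpha>) / \<alpha>) + c * ln (fact n) - (\<Sum>j\<in>{1..n}. ln (\<sigma> j)) - ln n / (2 * \<alpha>) + L \<alpha> \<sigma> n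
    \<le> n * (ln \<epsilon> + ln (kappa \<alpha> \<sigma> n)) - ln (kappa \<alpha> \<sigma> 1) + ln (2 / \<alpha>) / \<alpha> + c / 2 * ln n - ln n / (2 * \<alpha>)
      + integral {1..real n} (\<lambda>x. ln (\<sigma> x)) - (\<Sum>j\<in>{1..n}. ln (\<sigma> j)) + \<bar>c\<bar> * (B + 1)"
proof -
  let ?k = "kappa \<alpha> \<sigma>" and ?I = "integral {1..real n} (\<lambda>x. ln (\<sigma> x))"
  have "c * (ln (fact n) - stirling n - 1) \<le> \<bar>c\<bar> * \<bar>ln (fact n) - stirling n - 1\<bar>"
    by (metis abs_ge_self abs_mult)
  also have "\<dots> \<le> \<bar>c\<bar> * (B + 1)" using B by (intro mult_left_mono) auto
  finally have "c * ln (fact n) - c * stirling n - c \<le> \<bar>c\<bar> * (B + 1)"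
    by (simp add: right_diff_distrib)
  moreover have "c * stirling n = c * (n * ln n - n) + c / 2 * ln n"
    by (simp add: stirling_def algebra_simps)
  moreover have "L \<alpha> \<sigma> n = n * ln (?k n) - ln (?k 1) - n * (ln (2 / \<alpha>) / \<alpha>) + ln (2 / \<alpha>) / \<alpha>
      - c * (n * ln n - n) - c + ?I"
    using L_eq[of n] integral_ln_kappa[of n] n
    by (simp only: c_def[symmetric]) (simp add: algebra_simps diff_divide_distrib)
  ultimately show ?thesis unfolding distrib_left by linarith
qed

lemma ln_eps_add_ln_kappa_le_0:
  assumes "1 \<le> x" "0 < \<epsilon>" "\<epsilon> * kappa \<alpha> \<sigma> x \<le> 1"
  shows "ln \<epsilon> + ln (kappa \<alpha> \<sigma> x) \<le> 0"
  using ln_le_zero_iff[of "\<epsilon> * kappa \<alpha> \<sigma> x"] assms kappa_pos[of x] by (simp add: ln_mult_pos)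

text \<open>
  For decreasing \<open>\<sigma>\<close> the sum of \<open>- ln \<circ> \<sigma>\<close> over \<open>{1..<n}\<close> is a lower Riemann sum of its integral. The
  unmatched summand at \<open>n\<close> is part of a full \<open>ln (kappa \<alpha> \<sigma> n) \<le> - ln \<epsilon>\<close>.
\<close>
lemma exponent_bound_antimono:
  fixes \<epsilon> B :: real and n :: nat
  defines "c \<equiv> (1 - \<alpha>) / \<alpha>"
  assumes anti: "antimono_on {1..} \<sigma>"
    and n: "1 \<le> n" and \<epsilon>: "0 < \<epsilon>" "\<epsilon> * kappa \<alpha> \<sigma> n \<le> 1"
    and B: "\<bar>ln (fact n) - stirling n\<bar> \<le> B"
  shows "n * ln \<epsilon> + n * (ln (2 / \<alpha>) / \<alpha>) + c * ln (fact n) - (\<Sum>j\<in>{1..n}. ln (\<sigma> j)) - ln n / (2 * \<alpha>)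
    \<le> - L \<alpha> \<sigma> n - (2 - \<alpha>) / (2 * \<alpha>) * ln n - ln \<epsilon> + \<bar>c\<bar> * (B + 1) - ln (kappa \<alpha> \<sigma> 1)"
proof -
  have le0: "ln \<epsilon> + ln (kappa \<alpha> \<sigma> n) \<le> 0" using ln_eps_add_ln_kappa_le_0 n \<epsilon> by simp
  then have "n * (ln \<epsilon> + ln (kappa \<alpha> \<sigma> n)) \<le> 0" by (intro mult_nonneg_nonpos) auto
  moreover have "(\<Sum>j\<in>{1..<n}. - ln (\<sigma> (real j))) \<le> integral {1..real n} (\<lambda>x. - ln (\<sigma> x))"
  proof (rule sum_le_integral_of_mono[OF _ _ n])
    show "mono_on {1..} (\<lambda>x. - ln (\<sigma> x))"
      using \<sigma>(1) monotone_onD[OF anti] by (intro monotone_onI) (simp add: order_trans)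
    show "continuous_on {1..} (\<lambda>x. - ln (\<sigma> x))"
      by (intro continuous_on_minus continuous_on_ln_sigma)
  qed
  then have "integral {1..real n} (\<lambda>x. ln (\<sigma> x)) \<le> (\<Sum>j\<in>{1..<n}. ln (\<sigma> (real j)))" by (simp add: sum_negf)
  moreover have "(\<Sum>j\<in>{1..n}. ln (\<sigma> (real j))) = (\<Sum>j\<in>{1..<n}. ln (\<sigma> (real j))) + ln (\<sigma> n)"
    using n by (simp add: atLeastLessThanSuc_atLeastAtMost[symmetric])
  moreover have "(2 - \<alpha>) / (2 * \<alpha>) * ln n = ln n / (2 * \<alpha>) + c / 2 * ln n"
    using \<alpha> by (simp add: c_def field_simps)
  moreover have "ln (kappa \<alpha> \<sigma> n) = ln (2 / \<alpha>) / \<alpha> + c * ln n - ln (\<sigma> n)"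
    using ln_kappa n by (simp add: c_def)
  ultimately show ?thesis
    using ball_exponent_add_L_le[OF n B, of \<epsilon>, folded c_def] le0 by linarith
qed

text \<open>
  For convex \<open>ln \<circ> \<sigma>\<close> the trapezoidal rule compares the integral with the sum in which the summands at
  \<open>1\<close> and \<open>n\<close> are halved. Thus only half of \<open>ln (kappa \<alpha> \<sigma> n)\<close> is left over, which
  improves \<open>- ln \<epsilon>\<close> to \<open>- ln \<epsilon> / 2\<close>; the halved summand at \<open>1\<close> also halves \<open>ln (kappa \<alpha> \<sigma> 1)\<close>.
\<close>
lemma exponent_bound_convex:
  fixes \<epsilon> B :: real and n :: nat
  defines "c \<equiv> (1 - \<alpha>) / \<alpha>"
  assumes conv: "convex_on {1..} (\<lambda>x. ln (\<sigma> x))"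
    and n: "1 \<le> n" and \<epsilon>: "0 < \<epsilon>" "\<epsilon> * kappa \<alpha> \<sigma> n \<le> 1"
    and B: "\<bar>ln (fact n) - stirling n\<bar> \<le> B"
  shows "n * ln \<epsilon> + n * (ln (2 / \<alpha>) / \<alpha>) + c * ln (fact n) - (\<Sum>j\<in>{1..n}. ln (\<sigma> j)) - ln n / (2 * \<alpha>)
    \<le> - L \<alpha> \<sigma> n - 1 / (2 * \<alpha>) * ln (\<epsilon> powr \<alpha> * n) + \<bar>c\<bar> * (B + 1) - ln (kappa \<alpha> \<sigma> 1) / 2"
proof -
  have le0: "ln \<epsilon> + ln (kappa \<alpha> \<sigma> n) \<le> 0" using ln_eps_add_ln_kappa_le_0 n \<epsilon> by simp
  then have "n * (ln \<epsilon> + ln (kappa \<alpha> \<sigma> n)) \<le> 0" by (intro mult_nonneg_nonpos) auto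
  moreover have "integral {1..real n} (\<lambda>x. ln (\<sigma> x)) \<le> (\<Sum>j\<in>{1..n}. ln (\<sigma> (real j))) - ln (\<sigma> 1) / 2 - ln (\<sigma> n) / 2"
    using integral_le_trapezoid_of_convex[OF conv continuous_on_ln_sigma n]
    by (simp add: add_divide_distrib)
  moreover have "1 / (2 * \<alpha>) * ln (\<epsilon> powr \<alpha> * n) = ln \<epsilon> / 2 + ln n / (2 * \<alpha>)"
    using \<alpha> \<epsilon> n by (simp add: ln_mult_pos ln_powr field_simps)
  moreover have "ln (kappa \<alpha> \<sigma> n) = ln (2 / \<alpha>) / \<alpha> + c * ln n - ln (\<sigma> n)" "ln (kappa \<alpha> \<sigma> 1) = ln (2 / \<alpha>) / \<alpha> - ln (\<sigma> 1)"
    using ln_kappa n by (simp_all add: c_def)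
  ultimately show ?thesis
    using ball_exponent_add_L_le[OF n B, of \<epsilon>, folded c_def] le0 by linarith
qed

end

section \<open>The small ball inequalities\<close>

text \<open>
  The constant does not depend on \<open>\<sigma>\<close>, \<open>\<epsilon>\<close> and \<open>n\<close>: the sequence \<open>lam\<close> enters the ball estimate only
  through the product of its square roots, which \<open>\<sigma>\<close> bounds from below.
\<close>
lemma stable_ball_le_exp:
  fixes \<alpha> :: real
  assumes \<alpha>: "0 < \<alpha>" "\<alpha> \<le> 2"
  obtains C where "\<And>(lam :: nat \<Rightarrow> real) \<nu> \<sigma> (\<epsilon>::real) (n::nat).
      (\<And>i. 0 < lam i) \<Longrightarrow> prob_space \<nu> \<Longrightarrow> sets \<nu> = sets borel \<Longrightarrow>
      (\<And>y. charf \<nu> y =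
        complex_of_real (exp (- (1 / 2) * (\<Sum>i. lam i * (coord y i)\<^sup>2) powr (\<alpha> / 2)))) \<Longrightarrow>
      (\<And>j::nat. 1 \<le> j \<Longrightarrow> 0 < \<sigma> (real j)) \<Longrightarrow>
      (\<And>j::nat. 1 \<le> j \<Longrightarrow> \<sigma> (real j) \<le> sqrt (lam (j - 1))) \<Longrightarrow> 0 < \<epsilon> \<Longrightarrow> 1 \<le> n \<Longrightarrow>
      measure \<nu> (cball 0 \<epsilon>) \<le> exp (C + (n * ln \<epsilon> + n * (ln (2 / \<alpha>) / \<alpha>) + (1 - \<alpha>) / \<alpha> * ln (fact n) -
        (\<Sum>j\<in>{1..n}. ln (\<sigma> (real j))) - ln n / (2 * \<alpha>)))"
proof -
  obtain C where C: "\<And>n::nat. n \<ge> 1 \<Longrightarrow> 2 * ln (unit_ball_vol (real n)) - n * ln (2 * pi) + n / \<alpha> * ln 2 + ln (Gamma (n / \<alpha> + 1)) \<le>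
     n / \<alpha> * ln (2 / \<alpha>) + (1 - \<alpha>) / \<alpha> * ln (fact n) - ln n / (2 * \<alpha>) + C"
    using ball_gamma_factor_bound[OF \<alpha>] by blast
  show ?thesis
  proof (rule that[of C])
    fix lam :: "nat \<Rightarrow> real" and \<nu> :: "ell2 measure" and \<sigma> :: "real \<Rightarrow> real" and \<epsilon> :: real and n :: nat
    assume lam: "\<And>i. 0 < lam i" and \<nu>: "prob_space \<nu>" "sets \<nu> = sets borel"
        "\<And>y. charf \<nu> y = complex_of_real (exp (- (1 / 2) * (\<Sum>i. lam i * (coord y i)\<^sup>2) powr (\<alpha> / 2)))"
      and \<sigma>: "\<And>j::nat. 1 \<le> j \<Longrightarrow> 0 < \<sigma> (real j)" "\<And>j::nat. 1 \<le> j \<Longrightarrow> \<sigma> (real j) \<le> sqrt (lam (j - 1))"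
      and \<epsilon>: "0 < \<epsilon>" and n: "1 \<le> n"
    let ?g = "Gamma (n / \<alpha> + 1)" and ?w = "unit_ball_vol (real n)"
    have g: "0 < ?g" using \<alpha> by (intro Gamma_real_pos add_nonneg_pos) auto
    have w: "0 < ?w" by simp
    have "(\<Sum>j\<in>{1..n}. ln (\<sigma> (real j))) = (\<Sum>i<n. ln (\<sigma> (real (Suc i))))"
      by (simp add: sum.atLeast1_atMost_eq)
    also have "\<dots> \<le> (\<Sum>i<n. ln (sqrt (lam i)))"
    proof (rule sum_mono)
      fix i
      have "0 < \<sigma> (real (Suc i))" "\<sigma> (real (Suc i)) \<le> sqrt (lam i)"
        using \<sigma>(1)[of "Suc i"] \<sigma>(2)[of "Suc i"] by auto
      then show "ln (\<sigma> (real (Suc i))) \<le> ln (sqrt (lam i))" by (intro ln_mono)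
    qed
    finally have sum: "(\<Sum>j\<in>{1..n}. ln (\<sigma> (real j))) \<le> (\<Sum>i<n. ln (sqrt (lam i)))" .
    have "measure \<nu> (cball 0 \<epsilon>) \<le> \<epsilon> ^ n * ?w\<^sup>2 * (1 / (2 * pi)) ^ n * 2 powr (n / \<alpha>) * ?g / (\<Prod>i<n. sqrt (lam i))"
      by (rule stable_ball_le[OF \<alpha>(1) \<epsilon> lam \<nu>])
    also have "\<dots> = exp (n * ln \<epsilon> + (2 * ln ?w - n * ln (2 * pi) + n / \<alpha> * ln 2 + ln ?g) - (\<Sum>i<n. ln (sqrt (lam i))))"
    proof -
      have "exp (real n * ln \<epsilon>) = \<epsilon> ^ n" using \<epsilon> by (simp add: exp_of_nat_mult)
      moreover have "exp (2 * ln ?w) = ?w\<^sup>2" using w exp_of_nat_mult[of 2 "ln ?w"] by simp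
      moreover have "exp (real n * ln (2 * pi)) = (2 * pi) ^ n" by (subst exp_of_nat_mult) simp
      moreover have "exp (n / \<alpha> * ln 2) = 2 powr (n / \<alpha>)" by (simp add: powr_def)
      moreover have "exp (ln ?g) = ?g" using g by simp
      moreover have "exp (\<Sum>i<n. ln (sqrt (lam i))) = (\<Prod>i<n. sqrt (lam i))"
        using lam by (simp add: exp_sum)
      ultimately show ?thesis by (simp only: exp_add exp_diff) (simp add: power_divide)
    qed
    also have "\<dots> \<le> exp (C + (n * ln \<epsilon> + n * (ln (2 / \<alpha>) / \<alpha>) + (1 - \<alpha>) / \<alpha> * ln (fact n) -
        (\<Sum>j\<in>{1..n}. ln (\<sigma> (real j))) - ln n / (2 * \<alpha>)))"
      using C[OF n] sum by simp
    finally show "measure \<nu> (cball 0 \<epsilon>) \<le> exp (C + (n * ln \<epsilon> + n * (ln (2 / \<alpha>) / \<alpha>) + (1 - \<alpha>) / \<alpha> * ln (fact n) -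
        (\<Sum>j\<in>{1..n}. ln (\<sigma> (real j))) - ln n / (2 * \<alpha>)))" .
  qed
qed

(* Sequences are indexed from 0: lam i and coord y i are the (i+1)-st entries. *)
theorem proposition3:
  fixes \<alpha> l1 :: real
  assumes "0 < \<alpha>" and "\<alpha> \<le> 2"
  shows "\<exists>C C' :: real. 0 < C \<and> 0 < C' \<and>
    (\<forall>(lam :: nat \<Rightarrow> real) (\<nu> :: ell2 measure) (\<sigma> :: real \<Rightarrow> real) (\<zeta> :: real \<Rightarrow> nat).
      lam 0 = l1 \<and> summable lam \<and> decseq lam \<and> (\<forall>i. 0 < lam i) \<and>
      prob_space \<nu> \<and> sets \<nu> = sets borel \<and>
      (\<forall>y. charf \<nu> y =
        complex_of_real (exp (- (1 / 2) * (\<Sum>i. lam i * (coord y i)\<^sup>2) powr (\<alpha> / 2)))) \<and>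
      (\<forall>x\<ge>1. 0 < \<sigma> x) \<and> \<sigma> differentiable_on {1..} \<and> antimono_on {1..} \<sigma> \<and>
      (\<forall>j::nat. 1 \<le> j \<longrightarrow> \<sigma> (real j) \<le> sqrt (lam (j - 1))) \<and>
      (\<forall>\<epsilon>>0. 1 \<le> \<zeta> \<epsilon>) \<and>
      (\<forall>\<epsilon>. 0 < \<epsilon> \<and> \<epsilon> < inverse (kappa \<alpha> \<sigma> 1) \<longrightarrow> \<epsilon> * kappa \<alpha> \<sigma> (real (\<zeta> \<epsilon>)) \<le> 1)
      \<longrightarrow>
      (\<forall>\<epsilon>. 0 < \<epsilon> \<and> \<epsilon> < inverse (kappa \<alpha> \<sigma> 1) \<longrightarrow>
        measure \<nu> (cball 0 \<epsilon>) \<le>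
          C * exp (- L \<alpha> \<sigma> (real (\<zeta> \<epsilon>)) - (2 - \<alpha>) / (2 * \<alpha>) * ln (real (\<zeta> \<epsilon>)) - ln \<epsilon>)) \<and>
      (convex_on {1..} (\<lambda>x. ln (\<sigma> x)) \<longrightarrow>
        (\<forall>\<epsilon>. 0 < \<epsilon> \<and> \<epsilon> < inverse (kappa \<alpha> \<sigma> 1) \<longrightarrow>
          measure \<nu> (cball 0 \<epsilon>) \<le>
            C' * exp (- L \<alpha> \<sigma> (real (\<zeta> \<epsilon>)) - 1 / (2 * \<alpha>) * ln (\<epsilon> powr \<alpha> * real (\<zeta> \<epsilon>))))))"
proof -
  obtain B where B: "\<And>x. x \<ge> 1 / 2 \<Longrightarrow> \<bar>ln (Gamma (x + 1)) - stirling x\<bar> \<le> B"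
    using ln_Gamma_stirling_bound by blast
  have fact: "\<bar>ln (fact n) - stirling n\<bar> \<le> B" if "1 \<le> n" for n :: nat
    using B[of "real n"] that by (simp add: Gamma_fact add.commute)
  define K where "K = \<bar>(1 - \<alpha>) / \<alpha>\<bar> * (B + 1)"
  define k where "k = ln (2 / \<alpha>) / \<alpha> - ln (sqrt l1)"
  obtain C where C: "\<And>(lam :: nat \<Rightarrow> real) \<nu> \<sigma> (\<epsilon>::real) (n::nat).
      (\<And>i. 0 < lam i) \<Longrightarrow> prob_space \<nu> \<Longrightarrow> sets \<nu> = sets borel \<Longrightarrow>
      (\<And>y. charf \<nu> y =
        complex_of_real (exp (- (1 / 2) * (\<Sum>i. lam i * (coord y i)\<^sup>2) powr (\<alpha> / 2)))) \<Longrightarrow>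
      (\<And>j::nat. 1 \<le> j \<Longrightarrow> 0 < \<sigma> (real j)) \<Longrightarrow>
      (\<And>j::nat. 1 \<le> j \<Longrightarrow> \<sigma> (real j) \<le> sqrt (lam (j - 1))) \<Longrightarrow> 0 < \<epsilon> \<Longrightarrow> 1 \<le> n \<Longrightarrow>
      measure \<nu> (cball 0 \<epsilon>) \<le> exp (C + (n * ln \<epsilon> + n * (ln (2 / \<alpha>) / \<alpha>) + (1 - \<alpha>) / \<alpha> * ln (fact n) -
        (\<Sum>j\<in>{1..n}. ln (\<sigma> (real j))) - ln n / (2 * \<alpha>)))"
    using stable_ball_le_exp[OF assms] by blast
  show ?thesis
  proof (rule exI[of _ "exp (C + K - k)"], rule exI[of _ "exp (C + K - k / 2)"], intro conjI exp_gt_zero allI impI; elim conjE)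
    fix lam :: "nat \<Rightarrow> real" and \<nu> :: "ell2 measure" and \<sigma> :: "real \<Rightarrow> real" and \<zeta> :: "real \<Rightarrow> nat" and \<epsilon> :: real
    assume l1: "lam 0 = l1" and lam: "\<forall>i. 0 < lam i" and \<nu>: "prob_space \<nu>" "sets \<nu> = sets borel"
        "\<forall>y. charf \<nu> y = complex_of_real (exp (- (1 / 2) * (\<Sum>i. lam i * (coord y i)\<^sup>2) powr (\<alpha> / 2)))"
      and \<sigma>: "\<forall>x\<ge>1. 0 < \<sigma> x" "\<sigma> differentiable_on {1..}" "antimono_on {1..} \<sigma>"
        "\<forall>j::nat. 1 \<le> j \<longrightarrow> \<sigma> (real j) \<le> sqrt (lam (j - 1))"
      and \<zeta>: "\<forall>\<epsilon>>0. 1 \<le> \<zeta> \<epsilon>"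
        "\<forall>\<epsilon>. 0 < \<epsilon> \<and> \<epsilon> < inverse (kappa \<alpha> \<sigma> 1) \<longrightarrow> \<epsilon> * kappa \<alpha> \<sigma> (real (\<zeta> \<epsilon>)) \<le> 1"
      and \<epsilon>: "0 < \<epsilon>" "\<epsilon> < inverse (kappa \<alpha> \<sigma> 1)"
    have n: "1 \<le> \<zeta> \<epsilon>" and \<epsilon>n: "\<epsilon> * kappa \<alpha> \<sigma> (real (\<zeta> \<epsilon>)) \<le> 1" using \<zeta> \<epsilon> by auto
    have pos: "\<And>x. 1 \<le> x \<Longrightarrow> 0 < \<sigma> x" using \<sigma>(1) by blast
    (* the only place where the constants acquire their dependence on l1 *)
    have "ln (\<sigma> 1) \<le> ln (sqrt l1)" using \<sigma>(4)[rule_format, of 1] pos[of 1] l1 by (intro ln_mono) auto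
    then have k: "k \<le> ln (kappa \<alpha> \<sigma> 1)"
      using ln_kappa[OF assms(1) pos \<sigma>(2), of 1] by (simp add: k_def)
    have ball: "measure \<nu> (cball 0 \<epsilon>) \<le> exp (C + (\<zeta> \<epsilon> * ln \<epsilon> + \<zeta> \<epsilon> * (ln (2 / \<alpha>) / \<alpha>) + (1 - \<alpha>) / \<alpha> * ln (fact (\<zeta> \<epsilon>)) -
        (\<Sum>j\<in>{1..\<zeta> \<epsilon>}. ln (\<sigma> (real j))) - ln (\<zeta> \<epsilon>) / (2 * \<alpha>)))"
      using lam \<nu> \<sigma>(4) pos \<epsilon>(1) n by (intro C[where lam = lam]) auto
    show "measure \<nu> (cball 0 \<epsilon>) \<le>
        exp (C + K - k) * exp (- L \<alpha> \<sigma> (real (\<zeta> \<epsilon>)) - (2 - \<alpha>) / (2 * \<alpha>) * ln (real (\<zeta> \<epsilon>)) - ln \<epsilon>)"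
      using exponent_bound_antimono[OF assms(1) pos \<sigma>(2,3) n \<epsilon>(1) \<epsilon>n fact[OF n]] k
      unfolding exp_add[symmetric] K_def[symmetric] by (intro order_trans[OF ball]) simp
    assume conv: "convex_on {1..} (\<lambda>x. ln (\<sigma> x))"
    show "measure \<nu> (cball 0 \<epsilon>) \<le>
        exp (C + K - k / 2) * exp (- L \<alpha> \<sigma> (real (\<zeta> \<epsilon>)) - 1 / (2 * \<alpha>) * ln (\<epsilon> powr \<alpha> * real (\<zeta> \<epsilon>)))"
      using exponent_bound_convex[OF assms(1) pos \<sigma>(2) conv n \<epsilon>(1) \<epsilon>n fact[OF n]] k
      unfolding exp_add[symmetric] K_def[symmetric] by (intro order_trans[OF ball]) simp
  qed
qed

end
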